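(* Let $A$ be a uniform algebra. Then the topology $\tau_r$ is Hausdorff on $Id(A)$ if and only if $A$ has spectral synthesis.
   Context: A uniform algebra is a uniformly closed subalgebra of $C(X)$ ($X$ a compact Hausdorff space, complex-valued functions, supremum norm) which contains the constants and separates the points of $X$. All Banach algebras are unital. Spectral synthesis: let $Max(A)$ be the maximal ideal space (character space) of $A$ with the Gelfand topology, and regard elements of $A$ as continuous functions on $Max(A)$ via the Gelfand transform. For a non-empty closed subset $F$ of $Max(A)$ let $I(F)$ be the ideal of elements of $A$ which vanish on $F$, and let $J(F)$ be the ideal of elements of $A$ which vanish in a neighbourhood of $F$ in $Max(A)$. $A$ has spectral synthesis if $J(F)$ is dense in $I(F)$ for each non-empty closed subset $F$ of $Max(A)$. Topologies on $Id(A)$: for a unital Banach algebra $A$, $Id(A)$ is the set (lattice) of all closed two-sided ideals of $A$. For $a\in A$ and $I\in Id(A)$, $\Vert a+I\Vert$ denotes the quotient norm of $a+I$ in $A/I$. The topology $\tau_u$ is the weakest topology on $Id(A)$ for which all the functions $I\mapsto\Vert a+I\Vert$ ($a\in A$) are upper semi-continuous. A net $(I_\alpha)$ in $Id(A)$ has the normality property with respect to $I\in Id(A)$ if, for every $a\in A$, $a\notin I$ implies $\liminf_\alpha\Vert a+I_\alpha\Vert>0$. The topology $\tau_n$ on $Id(A)$ is the topology whose closed sets are exactly the subsets $N\subseteq Id(A)$ such that whenever $(I_\alpha)$ is a net in $N$ having the normality property with respect to some $I\in Id(A)$, then $I\in N$. The topology $\tau_r$ is the topology on $Id(A)$ generated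 by $\tau_u$ and $\tau_n$ (their join). *)

theory Defs
  imports "HOL-Analysis.Analysis"
begin

section \<open>Bounded continuous functions as a normed algebra\<close>

instantiation bcontfun :: (topological_space, real_normed_algebra_1) real_normed_algebra_1
begin

definition times_bcontfun :: "('a \<Rightarrow>\<^sub>C 'b) \<Rightarrow> ('a \<Rightarrow>\<^sub>C 'b) \<Rightarrow> 'a \<Rightarrow>\<^sub>C 'b"
  where "times_bcontfun f g = Bcontfun (\<lambda>x. f x * g x)"

definition one_bcontfun :: "'a \<Rightarrow>\<^sub>C 'b"
  where "one_bcontfun = const_bcontfun 1"

lemma times_bcontfun_apply [simp]: "(f * g) x = f x * g x" for f g :: "'a \<Rightarrow>\<^sub>C 'b"
proof -
  have "(\<lambda>x. f x * g x) \<in> bcontfun"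
  proof (rule bcontfun_normI)
    show "continuous_on UNIV (\<lambda>x. f x * g x)"
      by (intro continuous_intros) auto
    show "norm (f x * g x) \<le> norm f * norm g" for x
      by (rule order_trans[OF norm_mult_ineq]) (intro mult_mono norm_bounded; simp)
  qed
  then show ?thesis
    by (simp add: times_bcontfun_def Bcontfun_inverse)
qed

lemma one_bcontfun_apply [simp]: "(1 :: 'a \<Rightarrow>\<^sub>C 'b) x = 1"
  by (simp add: one_bcontfun_def)

instance
proof
  fix f g h :: "'a \<Rightarrow>\<^sub>C 'b" and r :: real
  show "f * g * h = f * (g * h)" by (rule bcontfun_eqI) (simp add: mult.assoc)
  show "(f + g) * h = f * h + g * h" by (rule bcontfun_eqI) (simp add: distrib_right)
  show "f * (g + h) = f * g + f * h" by (rule bcontfun_eqI) (simp add: distrib_left)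
  show "r *\<^sub>R f * g = r *\<^sub>R (f * g)" by (rule bcontfun_eqI) simp
  show "f * r *\<^sub>R g = r *\<^sub>R (f * g)" by (rule bcontfun_eqI) simp
  show "1 * f = f" by (rule bcontfun_eqI) simp
  show "f * 1 = f" by (rule bcontfun_eqI) simp
  show "(0 :: 'a \<Rightarrow>\<^sub>C 'b) \<noteq> 1"
  proof
    assume "(0 :: 'a \<Rightarrow>\<^sub>C 'b) = 1"
    then have "(0 :: 'a \<Rightarrow>\<^sub>C 'b) undefined = (1 :: 'a \<Rightarrow>\<^sub>C 'b) undefined" by simp
    then show False by simp
  qed
  show "norm (f * g) \<le> norm f * norm g"
    by (rule norm_bound, unfold times_bcontfun_apply, rule order_trans[OF norm_mult_ineq])
      (intro mult_mono norm_bounded; simp)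
  have "norm (1 :: 'a \<Rightarrow>\<^sub>C 'b) \<le> 1" by (rule norm_bound) simp
  moreover have "1 \<le> norm (1 :: 'a \<Rightarrow>\<^sub>C 'b)"
    using norm_bounded[of "1 :: 'a \<Rightarrow>\<^sub>C 'b" undefined] by simp
  ultimately show "norm (1 :: 'a \<Rightarrow>\<^sub>C 'b) = 1" by simp
qed

end


section \<open>Uniform algebras\<close>

text \<open>
  For compact \<open>X\<close> the type \<open>X \<Rightarrow>\<^sub>C complex\<close> is \<open>C(X)\<close> with the supremum norm. It has no complex
  scalar multiplication of its own; \<open>c \<cdot> f\<close> is written as \<open>const_bcontfun c * f\<close>.
\<close>

definition uniform_algebra :: "('x::topological_space \<Rightarrow>\<^sub>C complex) set \<Rightarrow> bool" where
  "uniform_algebra A \<longleftrightarrow>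
     (\<forall>f\<in>A. \<forall>g\<in>A. f + g \<in> A \<and> f * g \<in> A) \<and>
     (\<forall>c. \<forall>f\<in>A. const_bcontfun c * f \<in> A) \<and>
     (\<forall>c. const_bcontfun c \<in> A) \<and>
     closed A \<and>
     (\<forall>x y. x \<noteq> y \<longrightarrow> (\<exists>f\<in>A. f x \<noteq> f y))"


section \<open>Spectral synthesis\<close>

text \<open>Characters are functionals on \<open>A\<close> only, hence the extensional function space.\<close>

definition characters ::
    "('x::topological_space \<Rightarrow>\<^sub>C complex) set \<Rightarrow> (('x \<Rightarrow>\<^sub>C complex) \<Rightarrow> complex) set" where
  "characters A = {\<phi> \<in> A \<rightarrow>\<^sub>E UNIV.
     (\<forall>f\<in>A. \<forall>g\<in>A. \<phi> (f + g) = \<phi> f + \<phi> g \<and> \<phi> (f * g) = \<phi> f * \<phi> g) \<and>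
     (\<forall>c. \<forall>f\<in>A. \<phi> (const_bcontfun c * f) = c * \<phi> f) \<and>
     (\<exists>f\<in>A. \<phi> f \<noteq> 0)}"

definition gelfand_topology ::
    "('x::topological_space \<Rightarrow>\<^sub>C complex) set \<Rightarrow> (('x \<Rightarrow>\<^sub>C complex) \<Rightarrow> complex) topology" where
  "gelfand_topology A = subtopology (product_topology (\<lambda>_. euclidean) A) (characters A)"

lemma topspace_gelfand_topology [simp]: "topspace (gelfand_topology A) = characters A"
  by (auto simp: gelfand_topology_def characters_def)

definition gelfand_transform :: "'f \<Rightarrow> ('f \<Rightarrow> complex) \<Rightarrow> complex" where
  "gelfand_transform a = (\<lambda>\<phi>. \<phi> a)"

definition vanishing_ideal ::
    "('x::topological_space \<Rightarrow>\<^sub>C complex) set \<Rightarrow> (('x \<Rightarrow>\<^sub>C complex) \<Rightarrow> complex) set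
      \<Rightarrow> ('x \<Rightarrow>\<^sub>C complex) set" where
  "vanishing_ideal A F = {a \<in> A. \<forall>\<phi>\<in>F. gelfand_transform a \<phi> = 0}"

definition nhd_vanishing_ideal ::
    "('x::topological_space \<Rightarrow>\<^sub>C complex) set \<Rightarrow> (('x \<Rightarrow>\<^sub>C complex) \<Rightarrow> complex) set
      \<Rightarrow> ('x \<Rightarrow>\<^sub>C complex) set" where
  "nhd_vanishing_ideal A F =
     {a \<in> A. \<exists>U. openin (gelfand_topology A) U \<and> F \<subseteq> U \<and> (\<forall>\<phi>\<in>U. gelfand_transform a \<phi> = 0)}"

text \<open>Density of \<open>J(F)\<close> in \<open>I(F)\<close>; the inclusion of \<open>J(F)\<close> in \<open>I(F)\<close> is automatic.\<close>

definition spectral_synthesis :: "('x::topological_space \<Rightarrow>\<^sub>C complex) set \<Rightarrow> bool" where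
  "spectral_synthesis A \<longleftrightarrow>
     (\<forall>F. closedin (gelfand_topology A) F \<and> F \<noteq> {} \<longrightarrow>
        vanishing_ideal A F \<subseteq> closure (nhd_vanishing_ideal A F))"


section \<open>The lattice of closed ideals and its topologies\<close>

text \<open>
  Here \<open>A\<close> is the carrier of a closed unital subalgebra of the ambient normed algebra. Since \<open>A\<close>
  contains the scalars, closure under multiplication by \<open>A\<close> includes closure under scalar
  multiplication.
\<close>

definition closed_ideals :: "'a::real_normed_algebra_1 set \<Rightarrow> 'a set set" where
  "closed_ideals A = {I. I \<subseteq> A \<and> closed I \<and> 0 \<in> I \<and>
     (\<forall>x\<in>I. \<forall>y\<in>I. x + y \<in> I) \<and> (\<forall>a\<in>A. \<forall>x\<in>I. a * x \<in> I \<and> x * a \<in> I)}"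

definition quotient_norm :: "'a::real_normed_vector \<Rightarrow> 'a set \<Rightarrow> real" where
  "quotient_norm a I = (INF x\<in>I. norm (a + x))"

definition upper_semicontinuous_map :: "'a topology \<Rightarrow> ('a \<Rightarrow> real) \<Rightarrow> bool" where
  "upper_semicontinuous_map T f \<longleftrightarrow> (\<forall>r. openin T {x \<in> topspace T. f x < r})"

definition tau_u :: "'a::real_normed_algebra_1 set \<Rightarrow> 'a set topology" where
  "tau_u A = topology_generated_by
     {{I \<in> closed_ideals A. quotient_norm a I < r} | a r. a \<in> A}"

lemma quotient_norm_nonneg: "I \<noteq> {} \<Longrightarrow> 0 \<le> quotient_norm a I"
  unfolding quotient_norm_def by (rule cINF_greatest) auto

lemma topspace_tau_u:
  assumes "A \<noteq> {}"
  shows "topspace (tau_u A) = closed_ideals A"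
proof -
  obtain a where a: "a \<in> A" using assms by blast
  have "I \<in> \<Union>{{I \<in> closed_ideals A. quotient_norm a I < r} | a r. a \<in> A}"
    if "I \<in> closed_ideals A" for I
  proof -
    have "I \<in> {I \<in> closed_ideals A. quotient_norm a I < quotient_norm a I + 1}"
      using that by simp
    then show ?thesis using a by blast
  qed
  then show ?thesis by (auto simp: tau_u_def)
qed

text \<open>
  The next two lemmas are the universal property of \<open>tau_u\<close>: it makes every quotient norm upper
  semicontinuous, and it is the weakest topology on the closed ideals that does so.
\<close>

lemma upper_semicontinuous_tau_u:
  assumes "a \<in> A"
  shows "upper_semicontinuous_map (tau_u A) (quotient_norm a)"
proof -
  have "topspace (tau_u A) = closed_ideals A"
    using assms by (intro topspace_tau_u) auto
  then show ?thesis
    using assms unfolding upper_semicontinuous_map_def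
    by (auto simp: tau_u_def intro!: topology_generated_by_Basis)
qed

lemma tau_u_weakest:
  assumes "topspace T = closed_ideals A"
    and "\<And>a. a \<in> A \<Longrightarrow> upper_semicontinuous_map T (quotient_norm a)"
    and "openin (tau_u A) U"
  shows "openin T U"
proof -
  have gen: "generate_topology_on
      {{I \<in> closed_ideals A. quotient_norm a I < r} | a r. a \<in> A} U"
    using assms(3) by (simp add: tau_u_def openin_topology_generated_by_iff)
  show ?thesis
    by (rule generate_topology_on_coarsest[OF _ _ gen])
      (use assms in \<open>auto simp: upper_semicontinuous_map_def\<close>)
qed

text \<open>
  Nets are indexed by a preordered directed set \<open>(D, le)\<close>; limits along a net are taken along the
  filter of its tails.
\<close>

definition directed_set :: "'i set \<Rightarrow> ('i \<Rightarrow> 'i \<Rightarrow> bool) \<Rightarrow> bool" where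
  "directed_set D le \<longleftrightarrow> D \<noteq> {} \<and> (\<forall>i\<in>D. le i i) \<and>
     (\<forall>i\<in>D. \<forall>j\<in>D. \<forall>k\<in>D. le i j \<longrightarrow> le j k \<longrightarrow> le i k) \<and>
     (\<forall>i\<in>D. \<forall>j\<in>D. \<exists>k\<in>D. le i k \<and> le j k)"

definition net_filter :: "'i set \<Rightarrow> ('i \<Rightarrow> 'i \<Rightarrow> bool) \<Rightarrow> 'i filter" where
  "net_filter D le = (INF i\<in>D. principal {j \<in> D. le i j})"

definition normality_property ::
    "'a::real_normed_algebra_1 set \<Rightarrow> 'i set \<Rightarrow> ('i \<Rightarrow> 'i \<Rightarrow> bool) \<Rightarrow> ('i \<Rightarrow> 'a set) \<Rightarrow> 'a set \<Rightarrow> bool"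
  where
  "normality_property A D le \<nu> I \<longleftrightarrow>
     (\<forall>a\<in>A. a \<notin> I \<longrightarrow> 0 < Liminf (net_filter D le) (\<lambda>i. ereal (quotient_norm a (\<nu> i))))"

text \<open>
  A definition cannot quantify over all index types. The one used here is large enough to index
  the canonical net of any filter on sets of ideals, so that nets with other index types give no
  further conditions (\<open>tau_n_closed_net\<close> below).
\<close>

definition tau_n_closed :: "'a::real_normed_algebra_1 set \<Rightarrow> 'a set set \<Rightarrow> bool" where
  "tau_n_closed A N \<longleftrightarrow> N \<subseteq> closed_ideals A \<and>
     (\<forall>(D :: ('a set \<times> 'a set set) set) le \<nu>. \<forall>I\<in>closed_ideals A.
        directed_set D le \<longrightarrow> \<nu> ` D \<subseteq> N \<longrightarrow> normality_property A D le \<nu> I \<longrightarrow> I \<in> N)"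

definition tau_n :: "'a::real_normed_algebra_1 set \<Rightarrow> 'a set topology" where
  "tau_n A = topology (\<lambda>U. U \<subseteq> closed_ideals A \<and> tau_n_closed A (closed_ideals A - U))"

definition tau_r :: "'a::real_normed_algebra_1 set \<Rightarrow> 'a set topology" where
  "tau_r A = topology_generated_by ({U. openin (tau_u A) U} \<union> {U. openin (tau_n A) U})"


subsection \<open>Index types do not matter, and \<open>tau_n\<close> is a topology\<close>

lemma directed_setD:
  assumes "directed_set D le"
  shows "D \<noteq> {}" "\<And>i. i \<in> D \<Longrightarrow> le i i"
    "\<And>i j k. i \<in> D \<Longrightarrow> j \<in> D \<Longrightarrow> k \<in> D \<Longrightarrow> le i j \<Longrightarrow> le j k \<Longrightarrow> le i k"
    "\<And>i j. i \<in> D \<Longrightarrow> j \<in> D \<Longrightarrow> \<exists>k\<in>D. le i k \<and> le j k"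
  using assms unfolding directed_set_def by blast+

lemma eventually_net_filter:
  assumes "directed_set D le"
  shows "eventually P (net_filter D le) \<longleftrightarrow> (\<exists>i\<in>D. \<forall>j\<in>D. le i j \<longrightarrow> P j)"
proof -
  have "eventually P (net_filter D le) \<longleftrightarrow> (\<exists>i\<in>D. eventually P (principal {j \<in> D. le i j}))"
    unfolding net_filter_def
  proof (rule eventually_INF_base)
    show "D \<noteq> {}" by (rule directed_setD(1)[OF assms])
    fix i j assume ij: "i \<in> D" "j \<in> D"
    from directed_setD(4)[OF assms ij] obtain k where k: "k \<in> D" "le i k" "le j k" by blast
    note tr = directed_setD(3)[OF assms]
    have "{l \<in> D. le k l} \<subseteq> {l \<in> D. le i l} \<inter> {l \<in> D. le j l}"
      using tr[OF ij(1) k(1) _ k(2)] tr[OF ij(2) k(1) _ k(3)] by auto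
    then have "principal {l \<in> D. le k l} \<le> inf (principal {l \<in> D. le i l}) (principal {l \<in> D. le j l})"
      by simp
    with k show "\<exists>k\<in>D. principal {l \<in> D. le k l}
        \<le> inf (principal {l \<in> D. le i l}) (principal {l \<in> D. le j l})"
      by blast
  qed
  then show ?thesis by (auto simp: eventually_principal)
qed

lemma net_filter_neq_bot:
  assumes "directed_set D le"
  shows "net_filter D le \<noteq> bot"
  unfolding trivial_limit_def eventually_net_filter[OF assms]
proof
  assume "\<exists>i\<in>D. \<forall>j\<in>D. le i j \<longrightarrow> False"
  then obtain i where i: "i \<in> D" "\<forall>j\<in>D. \<not> le i j" by blast
  with directed_setD(2)[OF assms i(1)] show False by blast
qed

lemma eventually_net_filter_mem:
  assumes "directed_set D le"
  shows "eventually (\<lambda>i. i \<in> D) (net_filter D le)"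
  unfolding eventually_net_filter[OF assms] using directed_setD(1)[OF assms] by blast

lemma Liminf_pos_iff:
  "0 < Liminf F (\<lambda>x. ereal (f x)) \<longleftrightarrow> (\<exists>c>0. eventually (\<lambda>x. c < f x) F)"
proof
  assume "0 < Liminf F (\<lambda>x. ereal (f x))"
  then obtain c where c: "0 < ereal c" "ereal c < Liminf F (\<lambda>x. ereal (f x))"
    by (metis ereal_dense2)
  from less_LiminfD[OF c(2)] c(1) show "\<exists>c>0. eventually (\<lambda>x. c < f x) F" by auto
next
  assume "\<exists>c>0. eventually (\<lambda>x. c < f x) F"
  then obtain c where c: "c > 0" "eventually (\<lambda>x. c < f x) F" by blast
  have "ereal c \<le> Liminf F (\<lambda>x. ereal (f x))"
    by (rule Liminf_bounded, rule eventually_mono[OF c(2)]) simp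
  moreover have "0 < ereal c" using c(1) by simp
  ultimately show "0 < Liminf F (\<lambda>x. ereal (f x))" by (rule less_le_trans[rotated])
qed

lemma tau_n_closed_filter:
  "tau_n_closed A N \<longleftrightarrow> N \<subseteq> closed_ideals A \<and>
     (\<forall>F. \<forall>I\<in>closed_ideals A. F \<noteq> bot \<longrightarrow> eventually (\<lambda>J. J \<in> N) F \<longrightarrow>
        (\<forall>a\<in>A. a \<notin> I \<longrightarrow> (\<exists>c>0. eventually (\<lambda>J. c < quotient_norm a J) F)) \<longrightarrow> I \<in> N)"
  (is "_ \<longleftrightarrow> _ \<and> ?R")
proof -
  have "?R" if cl: "tau_n_closed A N"
  proof (intro allI ballI impI)
    fix F I
    assume I: "I \<in> closed_ideals A" and F: "F \<noteq> bot" "eventually (\<lambda>J. J \<in> N) F"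
      and nrm: "\<forall>a\<in>A. a \<notin> I \<longrightarrow> (\<exists>c>0. eventually (\<lambda>J. c < quotient_norm a J) F)"
    define D where "D = {(J, E). J \<in> E \<and> J \<in> N \<and> eventually (\<lambda>K. K \<in> E) F}"
    define le :: "'a set \<times> 'a set set \<Rightarrow> 'a set \<times> 'a set set \<Rightarrow> bool"
      where "le p q \<longleftrightarrow> snd q \<subseteq> snd p" for p q
    have ex: "\<exists>J. (J, E) \<in> D" if "eventually (\<lambda>K. K \<in> E) F" for E
    proof -
      have "eventually (\<lambda>K. K \<in> E \<and> K \<in> N) F" using that F(2) by (rule eventually_conj)
      from eventually_happens'[OF F(1) this] show ?thesis using that by (auto simp: D_def)
    qed
    have dir: "directed_set D le"
      unfolding directed_set_def
    proof (intro conjI ballI impI)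
      show "D \<noteq> {}" using ex[of UNIV] by auto
      fix p q assume "p \<in> D" "q \<in> D"
      then have "eventually (\<lambda>K. K \<in> snd p \<inter> snd q) F"
        by (auto simp: D_def eventually_conj_iff)
      from ex[OF this] obtain J where "(J, snd p \<inter> snd q) \<in> D" by blast
      then show "\<exists>k\<in>D. le p k \<and> le q k"
        by (rule bexI[rotated]) (simp add: le_def)
    qed (auto simp: le_def)
    have "normality_property A D le fst I"
      unfolding normality_property_def Liminf_pos_iff eventually_net_filter[OF dir]
    proof (intro ballI impI)
      fix a assume "a \<in> A" "a \<notin> I"
      with nrm obtain c where c: "c > 0" "eventually (\<lambda>J. c < quotient_norm a J) F" by blast
      have "eventually (\<lambda>J. J \<in> {J. c < quotient_norm a J}) F" using c(2) by simp
      from ex[OF this] obtain J where "(J, {J. c < quotient_norm a J}) \<in> D" by blast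
      then have "\<exists>i\<in>D. \<forall>j\<in>D. le i j \<longrightarrow> c < quotient_norm a (fst j)"
        by (rule bexI[rotated]) (auto simp: le_def D_def)
      with c(1) show "\<exists>c>0. \<exists>i\<in>D. \<forall>j\<in>D. le i j \<longrightarrow> c < quotient_norm a (fst j)" by blast
    qed
    moreover have "fst ` D \<subseteq> N" by (auto simp: D_def)
    ultimately show "I \<in> N" using cl I dir unfolding tau_n_closed_def by blast
  qed
  moreover have "tau_n_closed A N" if sub: "N \<subseteq> closed_ideals A" and R: ?R
    unfolding tau_n_closed_def
  proof (intro conjI sub allI ballI impI)
    fix D :: "('a set \<times> 'a set set) set" and le \<nu> I
    assume I: "I \<in> closed_ideals A" and dir: "directed_set D le" and \<nu>: "\<nu> ` D \<subseteq> N"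
      and nrm: "normality_property A D le \<nu> I"
    have "filtermap \<nu> (net_filter D le) \<noteq> bot"
      using net_filter_neq_bot[OF dir] by (simp add: filtermap_bot_iff)
    moreover have "eventually (\<lambda>J. J \<in> N) (filtermap \<nu> (net_filter D le))"
      unfolding eventually_filtermap
      using eventually_net_filter_mem[OF dir] by (rule eventually_mono) (use \<nu> in blast)
    moreover have "\<forall>a\<in>A. a \<notin> I \<longrightarrow>
        (\<exists>c>0. eventually (\<lambda>J. c < quotient_norm a J) (filtermap \<nu> (net_filter D le)))"
      using nrm by (simp add: normality_property_def Liminf_pos_iff eventually_filtermap)
    ultimately show "I \<in> N" using R I by blast
  qed
  moreover have "N \<subseteq> closed_ideals A" if "tau_n_closed A N"
    using that by (simp add: tau_n_closed_def)
  ultimately show ?thesis by blast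
qed

lemma tau_n_closed_net:
  fixes D :: "'i set"
  assumes "tau_n_closed A N" "directed_set D le" "\<nu> ` D \<subseteq> N" "I \<in> closed_ideals A"
    and "normality_property A D le \<nu> I"
  shows "I \<in> N"
proof -
  note dir = assms(2)
  have "filtermap \<nu> (net_filter D le) \<noteq> bot"
    using net_filter_neq_bot[OF dir] by (simp add: filtermap_bot_iff)
  moreover have "eventually (\<lambda>J. J \<in> N) (filtermap \<nu> (net_filter D le))"
    unfolding eventually_filtermap
    using eventually_net_filter_mem[OF dir] by (rule eventually_mono) (use assms(3) in blast)
  moreover have "\<forall>a\<in>A. a \<notin> I \<longrightarrow>
      (\<exists>c>0. eventually (\<lambda>J. c < quotient_norm a J) (filtermap \<nu> (net_filter D le)))"
    using assms(5) by (simp add: normality_property_def Liminf_pos_iff eventually_filtermap)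
  ultimately show ?thesis using assms(1,4) unfolding tau_n_closed_filter by blast
qed

lemma tau_n_closed_Un:
  assumes "tau_n_closed A M" "tau_n_closed A N"
  shows "tau_n_closed A (M \<union> N)"
  unfolding tau_n_closed_filter
proof (intro conjI allI ballI impI)
  show "M \<union> N \<subseteq> closed_ideals A" using assms by (auto simp: tau_n_closed_def)
  fix F I
  assume I: "I \<in> closed_ideals A" and F: "F \<noteq> bot" "eventually (\<lambda>J. J \<in> M \<union> N) F"
    and nrm: "\<forall>a\<in>A. a \<notin> I \<longrightarrow> (\<exists>c>0. eventually (\<lambda>J. c < quotient_norm a J) F)"
  have step: "I \<in> L" if L: "tau_n_closed A L" and nb: "inf F (principal L) \<noteq> bot" for L
  proof -
    have "eventually (\<lambda>J. J \<in> L) (inf F (principal L))"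
      by (simp add: eventually_inf_principal)
    moreover have "\<forall>a\<in>A. a \<notin> I \<longrightarrow>
        (\<exists>c>0. eventually (\<lambda>J. c < quotient_norm a J) (inf F (principal L)))"
      using nrm by (meson filter_leD inf_le1)
    ultimately show ?thesis using L I nb unfolding tau_n_closed_filter by blast
  qed
  have "inf F (principal M) \<noteq> bot \<or> inf F (principal N) \<noteq> bot"
  proof (rule ccontr)
    assume "\<not> ?thesis"
    then have "eventually (\<lambda>J. J \<notin> M) F" "eventually (\<lambda>J. J \<notin> N) F"
      by (auto simp: trivial_limit_def eventually_inf_principal)
    with F(2) have "eventually (\<lambda>J. False) F" by eventually_elim auto
    with F(1) show False by (simp add: trivial_limit_def)
  qed
  then show "I \<in> M \<union> N" using step assms by blast
qed

lemma istopology_tau_n: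
  "istopology (\<lambda>U. U \<subseteq> closed_ideals A \<and> tau_n_closed A (closed_ideals A - U))"
  unfolding istopology_def
proof (intro conjI allI impI)
  fix S T
  assume "S \<subseteq> closed_ideals A \<and> tau_n_closed A (closed_ideals A - S)"
    and "T \<subseteq> closed_ideals A \<and> tau_n_closed A (closed_ideals A - T)"
  then show "S \<inter> T \<subseteq> closed_ideals A" "tau_n_closed A (closed_ideals A - S \<inter> T)"
    by (auto simp: Diff_Int intro: tau_n_closed_Un)
next
  fix \<K> :: "'a set set set"
  assume K: "\<forall>K\<in>\<K>. K \<subseteq> closed_ideals A \<and> tau_n_closed A (closed_ideals A - K)"
  then show "\<Union>\<K> \<subseteq> closed_ideals A" by blast
  show "tau_n_closed A (closed_ideals A - \<Union>\<K>)"
    unfolding tau_n_closed_def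
  proof (intro conjI allI ballI impI)
    fix D :: "('a set \<times> 'a set set) set" and le \<nu> I
    assume *: "I \<in> closed_ideals A" "directed_set D le" "\<nu> ` D \<subseteq> closed_ideals A - \<Union>\<K>"
      "normality_property A D le \<nu> I"
    have "I \<in> closed_ideals A - K" if "K \<in> \<K>" for K
      by (rule tau_n_closed_net[OF _ *(2) _ *(1,4)]) (use K that *(3) in auto)
    with *(1) show "I \<in> closed_ideals A - \<Union>\<K>" by blast
  qed auto
qed

lemma openin_tau_n:
  "openin (tau_n A) U \<longleftrightarrow> U \<subseteq> closed_ideals A \<and> tau_n_closed A (closed_ideals A - U)"
  unfolding tau_n_def by (simp add: topology_inverse'[OF istopology_tau_n])

lemma topspace_tau_n: "topspace (tau_n A) = closed_ideals A"
proof (rule antisym)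
  show "topspace (tau_n A) \<subseteq> closed_ideals A"
    using openin_topspace[of "tau_n A"] unfolding openin_tau_n by (rule conjunct1)
  have "tau_n_closed A {}"
    unfolding tau_n_closed_def using directed_setD(1) by blast
  then have "openin (tau_n A) (closed_ideals A)"
    by (simp add: openin_tau_n)
  then show "closed_ideals A \<subseteq> topspace (tau_n A)" by (rule openin_subset)
qed

lemma closedin_tau_n: "closedin (tau_n A) N \<longleftrightarrow> tau_n_closed A N"
proof -
  have "N \<subseteq> closed_ideals A" if "tau_n_closed A N"
    using that by (simp add: tau_n_closed_def)
  then show ?thesis
    by (auto simp: closedin_def topspace_tau_n openin_tau_n double_diff)
qed

lemma topspace_tau_r:
  assumes "A \<noteq> {}"
  shows "topspace (tau_r A) = closed_ideals A"
proof -
  have "topspace (tau_r A) = topspace (tau_u A) \<union> topspace (tau_n A)"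
    unfolding tau_r_def topology_generated_by_topspace by (auto simp: topspace_def)
  then show ?thesis using assms by (simp add: topspace_tau_u topspace_tau_n)
qed

end

theory Submission
  imports Defs
begin

text \<open>
  The proof works on a closed boundary \<open>\<Gamma>\<close> of \<open>A\<close>, a closed set of points on which every function
  of \<open>A\<close> attains its norm, and with synthesis relative to \<open>\<Gamma>\<close>: a function vanishing on a closed
  \<open>F \<subseteq> \<Gamma>\<close> is a limit of functions vanishing on a neighbourhood of \<open>F\<close> in \<open>\<Gamma>\<close>. Write \<open>I(E)\<close> for the
  ideal of the functions vanishing on \<open>E\<close>, and \<open>J(F)\<close> for the ideal of those vanishing on a
  neighbourhood of \<open>F\<close> in \<open>\<Gamma>\<close>.

  Synthesis on \<open>\<Gamma>\<close> is strong because it gives \<^emph>\<open>local units\<close> (\<open>ex_local_unit\<close>): if an ideal contains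
  \<open>b\<close> with \<open>b x = 1\<close>, then \<open>1 - b\<close> is within distance \<open>1\<close> of some \<open>j\<close> vanishing near \<open>x\<close>, so
  \<open>b + j\<close> is invertible and \<open>b / (b + j)\<close> lies in the ideal and equals \<open>1\<close> near \<open>x\<close>. By compactness
  an ideal without zeros on a compact set contains a function that is \<open>1\<close> there. Hence every
  character is an evaluation at a point of \<open>\<Gamma>\<close>, so that synthesis on \<open>\<Gamma>\<close> implies spectral synthesis.

  If \<open>A\<close> has spectral synthesis, it has synthesis on the whole space \<open>X\<close>, and by the local units each
  closed ideal is \<open>I(E)\<close> for its zero set \<open>E\<close>. Given distinct closed ideals, let \<open>x\<close> be a zero of
  the second but not of the first. Some \<open>e\<close> in the first ideal is \<open>1\<close> on a neighbourhood \<open>V\<close> of \<open>x\<close>,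
  and some \<open>c \<in> A\<close> vanishes off \<open>V\<close> with \<open>c x = 1\<close>. If \<open>\<parallel>e + K\<parallel> < 1/2\<close>, then \<open>K\<close> has no zero in the
  closure of \<open>V\<close>, so \<open>c \<in> K\<close>. Thus \<open>{K. \<parallel>e + K\<parallel> < 1/2}\<close> and \<open>{K. c \<notin> K}\<close> are disjoint; they are
  open for \<open>tau_u\<close> and \<open>tau_n\<close> respectively (\<open>separate_ideals\<close>).

  Conversely let \<open>tau_r\<close> be Hausdorff and let \<open>\<Gamma>\<close> be the Shilov boundary. A filter of ideals
  converges to \<open>K\<close> if the quotient norms of each \<open>b \<in> K\<close> tend to \<open>0\<close> and those of each \<open>b \<notin> K\<close> stay
  away from \<open>0\<close> (\<open>tau_r_eventually\<close>). In this sense \<open>I(\<Gamma> \<inter> V)\<close> tends to the closure of \<open>J(F)\<close> when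
  the open set \<open>V\<close> shrinks to \<open>F\<close>. Every open set meeting \<open>\<Gamma>\<close> contains peak sets, and if \<open>P\<close> is a
  finite disjoint union of peak sets then \<open>\<parallel>a + I(P)\<parallel>\<close> is the supremum of \<open>\<bar>a\<bar>\<close> over \<open>P\<close>. Hence, for
  fixed \<open>V\<close>, ideals \<open>I(P)\<close> with \<open>P \<subseteq> V\<close> filling up \<open>\<Gamma> \<inter> V\<close> tend to \<open>I(\<Gamma> \<inter> V)\<close>, and the iterated
  limit of the \<open>I(P)\<close> is the closure of \<open>J(F)\<close>. But each \<open>P\<close> is contained in \<open>V\<close>, so a function that
  vanishes on \<open>F\<close> is uniformly small on \<open>P\<close> once \<open>V\<close> is small: the same iterated limit is also \<open>I(F)\<close>.
  So the two ideals coincide, which is synthesis on \<open>\<Gamma>\<close>.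
\<close>

section \<open>Function ideals and boundaries\<close>

definition vanishing_on :: "('x::topological_space \<Rightarrow>\<^sub>C complex) set \<Rightarrow> 'x set \<Rightarrow> ('x \<Rightarrow>\<^sub>C complex) set" where
  "vanishing_on A E = {a \<in> A. \<forall>x\<in>E. apply_bcontfun a x = 0}"

definition locally_vanishing_on ::
    "('x::topological_space \<Rightarrow>\<^sub>C complex) set \<Rightarrow> 'x set \<Rightarrow> 'x set \<Rightarrow> ('x \<Rightarrow>\<^sub>C complex) set" where
  "locally_vanishing_on A \<Gamma> F = {a \<in> A. \<exists>V. open V \<and> F \<subseteq> V \<and> (\<forall>x\<in>\<Gamma> \<inter> V. apply_bcontfun a x = 0)}"

definition closed_boundary :: "('x::topological_space \<Rightarrow>\<^sub>C complex) set \<Rightarrow> 'x set \<Rightarrow> bool" where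
  "closed_boundary A \<Gamma> \<longleftrightarrow> closed \<Gamma> \<and> (\<forall>f\<in>A. \<exists>x\<in>\<Gamma>. norm (apply_bcontfun f x) = norm f)"

text \<open>
  Neighbourhoods are taken in \<open>\<Gamma>\<close> and not in the maximal ideal space, because the peak sets used to
  establish synthesis are found only near the Shilov boundary.
\<close>

definition synthesis_on :: "('x::topological_space \<Rightarrow>\<^sub>C complex) set \<Rightarrow> 'x set \<Rightarrow> bool" where
  "synthesis_on A \<Gamma> \<longleftrightarrow>
     (\<forall>F. closed F \<and> F \<subseteq> \<Gamma> \<longrightarrow> vanishing_on A F \<subseteq> closure (locally_vanishing_on A \<Gamma> F))"

lemma closed_boundaryE:
  assumes "closed_boundary A \<Gamma>" "f \<in> A"
  obtains x where "x \<in> \<Gamma>" "norm (apply_bcontfun f x) = norm f"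
  using assms by (auto simp: closed_boundary_def)

lemma power_bcontfun_apply [simp]: "(f ^ n) x = f x ^ n"
  for f :: "'x::topological_space \<Rightarrow>\<^sub>C complex"
  by (induction n) simp_all

section \<open>Quotient norms\<close>

lemma bdd_below_norms: "bdd_below ((\<lambda>x. norm (a + x)) ` I)" for a :: "'a::real_normed_vector"
  by (rule bdd_belowI[of _ 0]) auto

lemma quotient_norm_le: "x \<in> I \<Longrightarrow> quotient_norm a I \<le> norm (a + x)"
  unfolding quotient_norm_def by (rule cINF_lower[OF bdd_below_norms])

lemma quotient_norm_less_iff:
  "I \<noteq> {} \<Longrightarrow> quotient_norm a I < r \<longleftrightarrow> (\<exists>x\<in>I. norm (a + x) < r)"
  unfolding quotient_norm_def by (rule cINF_less_iff[OF _ bdd_below_norms])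

lemma closed_idealsD:
  assumes "I \<in> closed_ideals A"
  shows "I \<subseteq> A" "closed I" "0 \<in> I" "I \<noteq> {}"
    "x \<in> I \<Longrightarrow> y \<in> I \<Longrightarrow> x + y \<in> I" "a \<in> A \<Longrightarrow> x \<in> I \<Longrightarrow> a * x \<in> I"
  using assms by (auto simp: closed_ideals_def)

lemma bounded_linear_apply_bcontfun: "bounded_linear (\<lambda>f. apply_bcontfun f x)"
  for x :: "'x::topological_space" and f :: "'x \<Rightarrow>\<^sub>C 'b::real_normed_vector"
  by (rule bounded_linear_intro[of _ 1]) (simp_all add: norm_bounded)

section \<open>Closed ideals of a uniform algebra\<close>

locale compact_uniform_algebra =
  fixes A :: "('x::t2_space \<Rightarrow>\<^sub>C complex) set"
  assumes compact_UNIV: "compact (UNIV :: 'x set)"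
    and uniform_algebra: "uniform_algebra A"
begin

lemma add_mem: "f \<in> A \<Longrightarrow> g \<in> A \<Longrightarrow> f + g \<in> A"
  and mult_mem: "f \<in> A \<Longrightarrow> g \<in> A \<Longrightarrow> f * g \<in> A"
  and const_mem: "const_bcontfun c \<in> A"
  and closed_algebra: "closed A"
  and separates: "x \<noteq> y \<Longrightarrow> \<exists>f\<in>A. f x \<noteq> f y"
  using uniform_algebra unfolding uniform_algebra_def by auto

lemma one_mem: "1 \<in> A" and zero_mem: "0 \<in> A"
  using const_mem[of 1] const_mem[of 0] by (simp_all add: one_bcontfun_def)

lemma uminus_mem: "f \<in> A \<Longrightarrow> - f \<in> A"
proof -
  assume "f \<in> A"
  then have "const_bcontfun (-1) * f \<in> A" by (intro mult_mem const_mem)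
  moreover have "const_bcontfun (-1) * f = - f" by (rule bcontfun_eqI) simp
  ultimately show ?thesis by simp
qed

lemma diff_mem: "f \<in> A \<Longrightarrow> g \<in> A \<Longrightarrow> f - g \<in> A"
  using add_mem[of f "- g"] uminus_mem by simp

lemma power_mem: "f \<in> A \<Longrightarrow> f ^ n \<in> A"
  by (induction n) (auto intro: one_mem mult_mem)

lemma sum_mem: "(\<And>i. i \<in> S \<Longrightarrow> f i \<in> A) \<Longrightarrow> sum f S \<in> A"
  by (induction S rule: infinite_finite_induct) (auto intro: zero_mem add_mem)

lemmas mem_intros = add_mem mult_mem const_mem one_mem zero_mem uminus_mem diff_mem power_mem sum_mem

lemma compact_closed: "closed C \<Longrightarrow> compact (C :: 'x set)"
  using compact_Int_closed[OF compact_UNIV] by simp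

lemma ideal_uminus: "I \<in> closed_ideals A \<Longrightarrow> k \<in> I \<Longrightarrow> - k \<in> I"
proof -
  assume "I \<in> closed_ideals A" "k \<in> I"
  then have "(- 1) * k \<in> I" by (rule closed_idealsD(6)[OF _ uminus_mem[OF one_mem]])
  then show ?thesis by simp
qed

lemma closed_idealsI:
  assumes "S \<subseteq> A" "0 \<in> S" "\<And>x y. x \<in> S \<Longrightarrow> y \<in> S \<Longrightarrow> x + y \<in> S" "\<And>a x. a \<in> A \<Longrightarrow> x \<in> S \<Longrightarrow> a * x \<in> S"
  shows "closure S \<in> closed_ideals A"
proof -
  have comm: "x * a = a * x" for a x :: "'x \<Rightarrow>\<^sub>C complex" by (rule bcontfun_eqI) simp
  have "x + y \<in> closure S" if xy: "x \<in> closure S" "y \<in> closure S" for x y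
  proof -
    obtain f g where "\<And>n. f n \<in> S" "f \<longlonglongrightarrow> x" "\<And>n. g n \<in> S" "g \<longlonglongrightarrow> y"
      using xy unfolding closure_sequential by blast
    then have "\<And>n. f n + g n \<in> S" "(\<lambda>n. f n + g n) \<longlonglongrightarrow> x + y" using assms(3) by (auto intro: tendsto_intros)
    then show ?thesis unfolding closure_sequential by (intro exI[of _ "\<lambda>n. f n + g n"] conjI allI)
  qed
  moreover have "a * x \<in> closure S" if ax: "a \<in> A" "x \<in> closure S" for a x
  proof -
    obtain f where "\<And>n. f n \<in> S" "f \<longlonglongrightarrow> x"
      using ax unfolding closure_sequential by blast
    then have "\<And>n. a * f n \<in> S" "(\<lambda>n. a * f n) \<longlonglongrightarrow> a * x" using assms(4) ax by (auto intro: tendsto_intros)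
    then show ?thesis unfolding closure_sequential by (intro exI[of _ "\<lambda>n. a * f n"] conjI allI)
  qed
  moreover have "closure S \<subseteq> A" using assms(1) closed_algebra by (rule closure_minimal)
  moreover have "0 \<in> closure S" using assms(2) closure_subset by blast
  ultimately show ?thesis by (simp add: closed_ideals_def comm)
qed

lemma vanishing_on_closed_ideal: "vanishing_on A E \<in> closed_ideals A"
proof -
  have "closed {a :: 'x \<Rightarrow>\<^sub>C complex. a x = 0}" for x
    by (intro closed_Collect_eq continuous_on_const)
      (rule linear_continuous_on[OF bounded_linear_apply_bcontfun])
  then have "closed (A \<inter> (\<Inter>x\<in>E. {a. apply_bcontfun a x = 0}))"
    using closed_algebra by (intro closed_Int closed_INT) auto
  moreover have "A \<inter> (\<Inter>x\<in>E. {a. apply_bcontfun a x = 0}) = vanishing_on A E"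
    by (auto simp: vanishing_on_def)
  ultimately have "closure (vanishing_on A E) = vanishing_on A E" by simp
  moreover have "closure (vanishing_on A E) \<in> closed_ideals A"
    by (rule closed_idealsI) (auto simp: vanishing_on_def intro: mem_intros)
  ultimately show ?thesis by simp
qed

lemma closure_locally_vanishing_on_closed_ideal:
  "closure (locally_vanishing_on A \<Gamma> F) \<in> closed_ideals A"
proof (rule closed_idealsI)
  show "0 \<in> locally_vanishing_on A \<Gamma> F"
    by (auto simp: locally_vanishing_on_def intro: mem_intros exI[of _ UNIV])
  fix x y assume "x \<in> locally_vanishing_on A \<Gamma> F" "y \<in> locally_vanishing_on A \<Gamma> F"
  then obtain V W where "x \<in> A" "open V" "F \<subseteq> V" "\<forall>z\<in>\<Gamma> \<inter> V. x z = 0"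
    "y \<in> A" "open W" "F \<subseteq> W" "\<forall>z\<in>\<Gamma> \<inter> W. y z = 0"
    by (auto simp: locally_vanishing_on_def)
  then show "x + y \<in> locally_vanishing_on A \<Gamma> F"
    by (auto simp: locally_vanishing_on_def intro!: mem_intros exI[of _ "V \<inter> W"])
qed (force simp: locally_vanishing_on_def intro: mem_intros)+

section \<open>Neighbourhoods and convergence of ideals\<close>

lemma openin_tau_r_quotient_norm_less:
  "a \<in> A \<Longrightarrow> openin (tau_r A) {I \<in> closed_ideals A. quotient_norm a I < r}"
  unfolding tau_r_def tau_u_def
  by (intro topology_generated_by_Basis UnI1) (auto intro!: topology_generated_by_Basis)

text \<open>
  The complement is closed for \<open>tau_n\<close>: if \<open>c\<close> lies in all ideals of a net, then \<open>\<parallel>c + I\<parallel>\<close> is \<open>0\<close> along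
  the net, so by the normality property \<open>c\<close> lies in the limit.
\<close>

lemma openin_tau_r_not_mem:
  assumes c: "c \<in> A"
  shows "openin (tau_r A) {I \<in> closed_ideals A. c \<notin> I}"
proof -
  have "tau_n_closed A {I \<in> closed_ideals A. c \<in> I}"
    unfolding tau_n_closed_filter
  proof (intro conjI allI ballI impI)
    fix G I
    assume I: "I \<in> closed_ideals A" and G: "G \<noteq> bot" "eventually (\<lambda>J. J \<in> {I \<in> closed_ideals A. c \<in> I}) G"
      and nrm: "\<forall>a\<in>A. a \<notin> I \<longrightarrow> (\<exists>r>0. eventually (\<lambda>J. r < quotient_norm a J) G)"
    show "I \<in> {I \<in> closed_ideals A. c \<in> I}"
    proof (rule ccontr)
      assume "\<not> ?thesis"
      then obtain r where r: "r > 0" "eventually (\<lambda>J. r < quotient_norm c J) G" using c I nrm by auto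
      have "eventually (\<lambda>J. False) G"
        using r(2) G(2)
      proof eventually_elim
        case (elim J)
        then have "- c \<in> J" by (auto intro: ideal_uminus)
        from quotient_norm_le[OF this, of c] elim r(1) show False by simp
      qed
      with G(1) show False by (simp add: trivial_limit_def)
    qed
  qed auto
  moreover have "closed_ideals A - {I \<in> closed_ideals A. c \<notin> I} = {I \<in> closed_ideals A. c \<in> I}" by auto
  ultimately have "openin (tau_n A) {I \<in> closed_ideals A. c \<notin> I}" by (auto simp: openin_tau_n)
  then show ?thesis unfolding tau_r_def by (intro topology_generated_by_Basis) auto
qed

text \<open>
  The two hypotheses on quotient norms give convergence in \<open>tau_u\<close> and in \<open>tau_n\<close>. For \<open>tau_u\<close>: if
  \<open>\<parallel>a + K\<parallel> < r\<close>, then \<open>\<parallel>a + k\<parallel> < r\<close> for some \<open>k \<in> K\<close>, and \<open>\<parallel>a + I\<parallel> \<le> \<parallel>a + k\<parallel> + \<parallel>- k + I\<parallel>\<close>, where the last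
  term tends to \<open>0\<close>. For \<open>tau_n\<close>: if the filter met the complement of an open neighbourhood of \<open>K\<close>
  frequently, its trace there would have the normality property, and \<open>K\<close> would lie in the complement.
\<close>

lemma tau_r_eventually:
  assumes K: "K \<in> closed_ideals A" and G: "eventually (\<lambda>I. I \<in> closed_ideals A) G"
    and small: "\<And>b \<epsilon>. b \<in> K \<Longrightarrow> \<epsilon> > 0 \<Longrightarrow> eventually (\<lambda>I. quotient_norm b I < \<epsilon>) G"
    and large: "\<And>b. b \<in> A \<Longrightarrow> b \<notin> K \<Longrightarrow> \<exists>c>0. eventually (\<lambda>I. c < quotient_norm b I) G"
    and U: "openin (tau_r A) U" "K \<in> U"
  shows "eventually (\<lambda>I. I \<in> U) G"
proof -
  have gen: "eventually (\<lambda>I. I \<in> U) G"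
    if "generate_topology_on S U" "K \<in> U" and "\<And>B. B \<in> S \<Longrightarrow> K \<in> B \<Longrightarrow> eventually (\<lambda>I. I \<in> B) G"
    for S U
    using that
  proof (induction rule: generate_topology_on.induct)
    case (Int a b)
    then show ?case by (auto simp: eventually_conj_iff)
  next
    case (UN \<K>)
    then obtain k where k: "k \<in> \<K>" "K \<in> k" by blast
    then have "eventually (\<lambda>I. I \<in> k) G" using UN by blast
    then show ?case by eventually_elim (use k in auto)
  qed auto
  have u: "eventually (\<lambda>I. I \<in> B) G" if B: "openin (tau_u A) B" "K \<in> B" for B
  proof (rule gen[OF _ B(2)])
    show "generate_topology_on {{I \<in> closed_ideals A. quotient_norm a I < r} | a r. a \<in> A} B"
      using B(1) by (simp add: tau_u_def openin_topology_generated_by_iff)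
    fix C assume "C \<in> {{I \<in> closed_ideals A. quotient_norm a I < r} | a r. a \<in> A}" "K \<in> C"
    then obtain a r where C: "C = {I \<in> closed_ideals A. quotient_norm a I < r}" "a \<in> A" "quotient_norm a K < r"
      by blast
    then obtain k where k: "k \<in> K" "norm (a + k) < r"
      using quotient_norm_less_iff[OF closed_idealsD(4)[OF K]] by blast
    have "eventually (\<lambda>I. quotient_norm (- k) I < r - norm (a + k)) G"
      using k K by (intro small ideal_uminus) auto
    then show "eventually (\<lambda>I. I \<in> C) G"
      using G
    proof eventually_elim
      case (elim I)
      then obtain i where i: "i \<in> I" "norm (- k + i) < r - norm (a + k)"
        using quotient_norm_less_iff[OF closed_idealsD(4)[OF elim(2)]] by blast
      have "norm (a + i) \<le> norm (a + k) + norm (- k + i)"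
        using norm_triangle_ineq[of "a + k" "- k + i"] by (simp add: algebra_simps)
      with i(2) quotient_norm_le[OF i(1), of a] elim(2) show ?case by (simp add: C(1))
    qed
  qed
  have n: "eventually (\<lambda>I. I \<in> B) G" if B: "openin (tau_n A) B" "K \<in> B" for B
  proof (rule ccontr)
    assume ne: "\<not> ?thesis"
    define N where "N = closed_ideals A - B"
    have N: "tau_n_closed A N" using B(1) by (simp add: openin_tau_n N_def)
    have "inf G (principal N) \<noteq> bot"
    proof
      assume "inf G (principal N) = bot"
      then have "eventually (\<lambda>I. I \<notin> N) G" by (simp add: trivial_limit_def eventually_inf_principal)
      with G have "eventually (\<lambda>I. I \<in> B) G" by eventually_elim (auto simp: N_def)
      with ne show False ..
    qed
    moreover have "eventually (\<lambda>J. J \<in> N) (inf G (principal N))" by (simp add: eventually_inf_principal)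
    moreover have "\<forall>a\<in>A. a \<notin> K \<longrightarrow> (\<exists>c>0. eventually (\<lambda>J. c < quotient_norm a J) (inf G (principal N)))"
      using large by (meson filter_leD inf_le1)
    ultimately have "K \<in> N" using N K unfolding tau_n_closed_filter by blast
    with B(2) show False by (simp add: N_def)
  qed
  show ?thesis
    by (rule gen[OF _ U(2)]) (use U(1) u n in \<open>auto simp: tau_r_def openin_topology_generated_by_iff\<close>)
qed

section \<open>Units in ideals, relative to their zeros\<close>

text \<open>
  The partial sums of the Neumann series of \<open>w\<close> converge uniformly to \<open>1 / w\<close>, and \<open>A\<close> is closed.
\<close>

lemma ex_inverse_near_one:
  assumes w: "w \<in> A" and n: "norm (1 - w) < 1"
  shows "\<exists>v\<in>A. \<forall>x. w x * v x = 1"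
proof -
  define q where "q = norm (1 - w)"
  have q: "0 \<le> q" "q < 1" using n by (auto simp: q_def)
  have wq: "norm (1 - w x) \<le> q" for x
    using norm_bounded[of "1 - w" x] by (simp add: q_def)
  have lower: "1 - q \<le> norm (w x)" for x
    using wq[of x] norm_triangle_sub[of 1 "w x"] by (simp add: norm_minus_commute)
  have nz: "w x \<noteq> 0" for x using lower[of x] q by auto
  have bc: "(\<lambda>x. 1 / w x) \<in> bcontfun"
  proof (rule bcontfun_normI)
    show "continuous_on UNIV (\<lambda>x. 1 / w x)" by (intro continuous_intros) (use nz in auto)
    show "norm (1 / w x) \<le> 1 / (1 - q)" for x
      using lower[of x] q by (simp add: norm_divide frac_le)
  qed
  define v where "v = Bcontfun (\<lambda>x. 1 / w x)"
  have v: "v x = 1 / w x" for x by (simp add: v_def Bcontfun_inverse[OF bc])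
  define s where "s n = (\<Sum>k<n. (1 - w) ^ k)" for n
  have sx: "s n x = (\<Sum>k<n. (1 - w x) ^ k)" for n x
    unfolding s_def by (induction n) simp_all
  have "norm (s n - v) \<le> q ^ n / (1 - q)" for n
  proof (rule norm_bound)
    fix x
    have "s n x - v x = - ((1 - w x) ^ n) / w x"
      using nz[of x] by (simp add: sx v sum_gp_strict field_simps)
    then have "norm (s n x - v x) = norm (1 - w x) ^ n / norm (w x)"
      by (simp add: norm_divide norm_power)
    also have "\<dots> \<le> q ^ n / (1 - q)"
      using wq[of x] lower[of x] q by (intro frac_le power_mono) auto
    finally show "norm ((s n - v) x) \<le> q ^ n / (1 - q)" by simp
  qed
  moreover have "(\<lambda>n. q ^ n / (1 - q)) \<longlonglongrightarrow> 0 / (1 - q)"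
    using q by (intro tendsto_divide LIMSEQ_realpow_zero tendsto_const) auto
  ultimately have "s \<longlonglongrightarrow> v"
    by (subst Lim_null) (auto intro: Lim_null_comparison[where g = "\<lambda>n. q ^ n / (1 - q)"])
  moreover have "s n \<in> A" for n unfolding s_def using w by (intro mem_intros) auto
  ultimately have "v \<in> A" using closed_algebra closed_sequential_limits by blast
  then show ?thesis using nz by (intro bexI[of _ v]) (auto simp: v)
qed

text \<open>
  The unit is \<open>b / (b + j)\<close>, where \<open>b\<close> is scaled to \<open>b x = 1\<close> and \<open>j\<close> is a function vanishing near
  \<open>x\<close> that approximates \<open>1 - b\<close>.
\<close>

lemma ex_local_unit:
  assumes K: "\<And>a b. a \<in> A \<Longrightarrow> b \<in> K \<Longrightarrow> a * b \<in> K" "K \<subseteq> A"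
    and syn: "synthesis_on A \<Gamma>" and x: "x \<in> \<Gamma>" and nz: "\<exists>b\<in>K. b x \<noteq> 0"
  shows "\<exists>e\<in>K. \<exists>V. open V \<and> x \<in> V \<and> (\<forall>y\<in>\<Gamma> \<inter> V. e y = 1)"
proof -
  obtain b0 where b0: "b0 \<in> K" "b0 x \<noteq> 0" using nz by blast
  define b where "b = const_bcontfun (inverse (b0 x)) * b0"
  have b: "b \<in> K" "b x = 1" using b0 K const_mem by (auto simp: b_def)
  then have bA: "b \<in> A" using K by blast
  have "1 - b \<in> vanishing_on A {x}" using b bA by (auto simp: vanishing_on_def intro: mem_intros)
  then have "1 - b \<in> closure (locally_vanishing_on A \<Gamma> {x})"
    using syn x unfolding synthesis_on_def by (metis closed_singleton empty_subsetI insert_subset subsetD)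
  then obtain j where j: "j \<in> locally_vanishing_on A \<Gamma> {x}" "dist j (1 - b) < 1"
    unfolding closure_approachable using zero_less_one by blast
  then obtain V where V: "j \<in> A" "open V" "x \<in> V" "\<And>y. y \<in> \<Gamma> \<inter> V \<Longrightarrow> j y = 0"
    by (auto simp: locally_vanishing_on_def)
  have "norm (1 - (b + j)) < 1" using j(2) by (simp add: dist_norm norm_minus_commute algebra_simps)
  from ex_inverse_near_one[OF add_mem[OF bA V(1)] this]
  obtain v where v: "v \<in> A" "\<And>x. (b + j) x * v x = 1" by blast
  have "(v * b) y = 1" if "y \<in> \<Gamma> \<inter> V" for y
    using v(2)[of y] V(4)[OF that] by (simp add: mult.commute)
  with K(1)[OF v(1) b(1)] V(2,3) show ?thesis by blast
qed

lemma ex_unit_on_compact: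
  assumes K: "\<And>a b. a \<in> A \<Longrightarrow> b \<in> K \<Longrightarrow> a * b \<in> K" "K \<subseteq> A" "\<And>a b. a \<in> K \<Longrightarrow> b \<in> K \<Longrightarrow> a + b \<in> K" "0 \<in> K"
    and syn: "synthesis_on A \<Gamma>" and C: "closed C" "C \<subseteq> \<Gamma>" and nz: "\<And>x. x \<in> C \<Longrightarrow> \<exists>b\<in>K. b x \<noteq> 0"
  shows "\<exists>e\<in>K. \<forall>x\<in>C. e x = 1"
proof -
  have "\<forall>x\<in>C. \<exists>e V. e \<in> K \<and> open V \<and> x \<in> V \<and> (\<forall>y\<in>\<Gamma> \<inter> V. e y = 1)"
  proof
    fix x assume x: "x \<in> C"
    then have "x \<in> \<Gamma>" using C(2) by blast
    from ex_local_unit[OF K(1,2) syn this nz[OF x]]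
    show "\<exists>e V. e \<in> K \<and> open V \<and> x \<in> V \<and> (\<forall>y\<in>\<Gamma> \<inter> V. e y = 1)" by blast
  qed
  then obtain e V where eV: "\<And>x. x \<in> C \<Longrightarrow> e x \<in> K \<and> open (V x) \<and> x \<in> V x \<and> (\<forall>y\<in>\<Gamma> \<inter> V x. e x y = 1)"
    by metis
  obtain D where D: "D \<subseteq> C" "finite D" "C \<subseteq> (\<Union>x\<in>D. V x)"
    by (rule compactE_image[OF compact_closed[OF C(1)], of C V]) (use eV in auto)
  have "\<exists>g\<in>K. \<forall>y\<in>\<Gamma> \<inter> (\<Union>x\<in>D. V x). g y = 1"
    using D(2,1)
  proof (induction D rule: finite_induct)
    case empty
    show ?case using K(4) by (rule bexI[rotated]) simp
  next
    case (insert x D)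
    then obtain g where g: "g \<in> K" "\<And>y. y \<in> \<Gamma> \<Longrightarrow> y \<in> (\<Union>x\<in>D. V x) \<Longrightarrow> g y = 1" by blast
    have ex: "e x \<in> K" "\<And>y. y \<in> \<Gamma> \<Longrightarrow> y \<in> V x \<Longrightarrow> e x y = 1" using eV insert.prems by auto
    \<comment> \<open>\<open>1 - (1 - g) (1 - e)\<close> is \<open>1\<close> wherever \<open>g\<close> or \<open>e\<close> is.\<close>
    have "(1 - g) * e x + g \<in> K"
      using K(2) g(1) by (intro K(3) K(1) ex(1) g(1) diff_mem one_mem) blast
    moreover have "((1 - g) * e x + g) y = 1" if "y \<in> \<Gamma> \<inter> (\<Union>x\<in>insert x D. V x)" for y
    proof (cases "y \<in> V x")
      case True
      then show ?thesis using that ex(2)[of y] by simp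
    next
      case False
      then show ?thesis using that g(2)[of y] by simp
    qed
    ultimately show ?case by blast
  qed
  then obtain g where g: "g \<in> K" "\<forall>y\<in>\<Gamma> \<inter> (\<Union>x\<in>D. V x). g y = 1" by blast
  show ?thesis by (rule bexI[OF _ g(1)]) (use g(2) C(2) D(3) in blast)
qed

section \<open>Characters\<close>

definition evaluation :: "'x \<Rightarrow> ('x \<Rightarrow>\<^sub>C complex) \<Rightarrow> complex" where
  "evaluation x = (\<lambda>f\<in>A. apply_bcontfun f x)"

lemma evaluation_apply: "f \<in> A \<Longrightarrow> evaluation x f = f x"
  by (simp add: evaluation_def)

lemma evaluation_in_characters: "evaluation x \<in> characters A"
  unfolding characters_def
  using one_mem by (auto simp: evaluation_apply mem_intros evaluation_def intro!: bexI[of _ 1])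

lemma continuous_map_evaluation: "continuous_map euclidean (gelfand_topology A) evaluation"
  unfolding gelfand_topology_def
proof (rule continuous_map_into_subtopology)
  show "continuous_map euclidean (product_topology (\<lambda>_. euclidean) A) evaluation"
    unfolding continuous_map_componentwise
  proof (intro conjI ballI)
    show "evaluation ` topspace euclidean \<subseteq> extensional A" by (auto simp: evaluation_def)
    fix f assume "f \<in> A"
    then have "(\<lambda>x. evaluation x f) = apply_bcontfun f" by (auto simp: evaluation_apply)
    then show "continuous_map euclidean euclidean (\<lambda>x. evaluation x f)" by simp
  qed
qed (simp add: evaluation_in_characters)

text \<open>
  The image is compact, and the Gelfand topology is Hausdorff.
\<close>

lemma closedin_evaluation_image:
  assumes "closed C"
  shows "closedin (gelfand_topology A) (evaluation ` C)"
proof (rule compactin_imp_closedin)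
  show "Hausdorff_space (gelfand_topology A)"
    unfolding gelfand_topology_def
    by (intro Hausdorff_space_subtopology) (simp add: Hausdorff_space_product_topology)
  show "compactin (gelfand_topology A) (evaluation ` C)"
    using compact_closed[OF assms] by (intro image_compactin[OF _ continuous_map_evaluation]) simp
qed

text \<open>
  Closed sets of points become closed sets of characters under evaluation, and Gelfand neighbourhoods
  pull back to neighbourhoods. Only the empty set, which \<open>spectral_synthesis\<close> excludes, is separate:
  there the zero condition is void.
\<close>

lemma spectral_synthesis_imp_synthesis_on:
  assumes "spectral_synthesis A"
  shows "synthesis_on A UNIV"
  unfolding synthesis_on_def
proof (intro allI impI)
  fix F :: "'x set" assume F: "closed F \<and> F \<subseteq> UNIV"
  show "vanishing_on A F \<subseteq> closure (locally_vanishing_on A UNIV F)"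
  proof (cases "F = {}")
    case True
    then have "vanishing_on A F \<subseteq> locally_vanishing_on A UNIV F"
      by (auto simp: vanishing_on_def locally_vanishing_on_def intro: exI[of _ "{}"])
    then show ?thesis using closure_subset by blast
  next
    case False
    have "vanishing_on A F \<subseteq> vanishing_ideal A (evaluation ` F)"
      by (auto simp: vanishing_on_def vanishing_ideal_def gelfand_transform_def evaluation_apply)
    also have "\<dots> \<subseteq> closure (nhd_vanishing_ideal A (evaluation ` F))"
      using assms closedin_evaluation_image[of F] F False unfolding spectral_synthesis_def by blast
    also have "\<dots> \<subseteq> closure (locally_vanishing_on A UNIV F)"
    proof (rule closure_mono, rule subsetI)
      fix a assume "a \<in> nhd_vanishing_ideal A (evaluation ` F)"
      then obtain U where U: "a \<in> A" "openin (gelfand_topology A) U" "evaluation ` F \<subseteq> U" "\<And>\<phi>. \<phi> \<in> U \<Longrightarrow> \<phi> a = 0"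
        by (auto simp: nhd_vanishing_ideal_def gelfand_transform_def)
      have "open {x. evaluation x \<in> U}"
        using openin_continuous_map_preimage[OF continuous_map_evaluation U(2)] by simp
      moreover have "a x = 0" if "evaluation x \<in> U" for x
        using U(4)[OF that] U(1) by (simp add: evaluation_apply)
      ultimately show "a \<in> locally_vanishing_on A UNIV F"
        unfolding locally_vanishing_on_def using U(1,3) by (auto intro!: exI[of _ "{x. evaluation x \<in> U}"])
    qed
    finally show ?thesis .
  qed
qed

text \<open>
  If the kernel of the character had no common zero on \<open>\<Gamma>\<close>, it would contain a function equal to \<open>1\<close>
  on \<open>\<Gamma>\<close>, which is the unit of \<open>A\<close> since \<open>\<Gamma>\<close> determines norms. So it has a common zero \<open>x\<close>, and
  \<open>f - \<phi> f\<close> vanishes at \<open>x\<close> for every \<open>f\<close>.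
\<close>

lemma character_eq_evaluation:
  assumes bd: "closed_boundary A \<Gamma>" and syn: "synthesis_on A \<Gamma>" and \<phi>: "\<phi> \<in> characters A"
  shows "\<exists>x\<in>\<Gamma>. \<phi> = evaluation x"
proof -
  define K where "K = {f \<in> A. \<phi> f = 0}"
  have add: "\<phi> (f + g) = \<phi> f + \<phi> g" and mult: "\<phi> (f * g) = \<phi> f * \<phi> g" if "f \<in> A" "g \<in> A" for f g
    using \<phi> that by (auto simp: characters_def)
  have scale: "\<phi> (const_bcontfun c * f) = c * \<phi> f" if "f \<in> A" for c f
    using \<phi> that by (auto simp: characters_def)
  obtain f0 where f0: "f0 \<in> A" "\<phi> f0 \<noteq> 0" using \<phi> by (auto simp: characters_def)
  have one: "\<phi> 1 = 1" using mult[OF f0(1) one_mem] f0(2) by simp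
  have const: "\<phi> (const_bcontfun c) = c" for c
  proof -
    have "const_bcontfun c * (1 :: 'x \<Rightarrow>\<^sub>C complex) = const_bcontfun c" by (rule bcontfun_eqI) simp
    then show ?thesis using scale[OF one_mem, of c] one by simp
  qed
  have "\<exists>x\<in>\<Gamma>. \<forall>b\<in>K. b x = 0"
  proof (rule ccontr)
    assume no: "\<not> ?thesis"
    have "\<exists>e\<in>K. \<forall>x\<in>\<Gamma>. e x = 1"
    proof (rule ex_unit_on_compact[OF _ _ _ _ syn])
      show "0 \<in> K" using const[of 0] zero_mem by (simp add: K_def)
      show "closed \<Gamma>" using bd by (simp add: closed_boundary_def)
    qed (use no in \<open>auto simp: K_def add mult intro: mem_intros\<close>)
    then obtain e where e: "e \<in> A" "\<phi> e = 0" "\<forall>x\<in>\<Gamma>. e x = 1" by (auto simp: K_def)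
    obtain x where "x \<in> \<Gamma>" "norm ((1 - e) x) = norm (1 - e)"
      by (rule closed_boundaryE[OF bd diff_mem[OF one_mem e(1)]])
    then have "norm (1 - e) = 0" using e(3) by simp
    then have "e = 1" by simp
    with one e(2) show False by simp
  qed
  then obtain x where x: "x \<in> \<Gamma>" "\<And>b. b \<in> K \<Longrightarrow> b x = 0" by blast
  have "\<phi> f = f x" if f: "f \<in> A" for f
  proof -
    have "const_bcontfun (- \<phi> f) + f \<in> K" using f add[OF const_mem f] const by (auto simp: K_def intro: mem_intros)
    from x(2)[OF this] show ?thesis by simp
  qed
  moreover have "\<phi> \<in> extensional A" using \<phi> by (auto simp: characters_def PiE_def)
  ultimately have "\<phi> = evaluation x"
    by (intro extensionalityI[of _ A]) (auto simp: evaluation_def)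
  with x(1) show ?thesis by blast
qed

text \<open>
  All characters are evaluations at \<open>\<Gamma>\<close>, so \<open>F\<close> corresponds to a closed \<open>E \<subseteq> \<Gamma>\<close>. If a function
  vanishes on \<open>\<Gamma> \<inter> V\<close> with \<open>V\<close> open and \<open>E \<subseteq> V\<close>, then it vanishes on all characters outside the
  compact image of \<open>\<Gamma> - V\<close>, which is a Gelfand neighbourhood of \<open>F\<close>.
\<close>

lemma synthesis_on_imp_spectral_synthesis:
  assumes bd: "closed_boundary A \<Gamma>" and syn: "synthesis_on A \<Gamma>"
  shows "spectral_synthesis A"
  unfolding spectral_synthesis_def
proof (intro allI impI)
  fix F assume "closedin (gelfand_topology A) F \<and> F \<noteq> {}"
  then have F: "closedin (gelfand_topology A) F" by blast
  then have Fsub: "F \<subseteq> characters A" using closedin_subset by fastforce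
  have cG: "closed \<Gamma>" using bd by (simp add: closed_boundary_def)
  define E where "E = \<Gamma> \<inter> {x. evaluation x \<in> F}"
  have "closed {x. evaluation x \<in> F}"
    using closedin_continuous_map_preimage[OF continuous_map_evaluation F] by simp
  then have "closed E" using cG by (auto simp: E_def)
  have "vanishing_ideal A F \<subseteq> vanishing_on A E"
  proof
    fix a assume a: "a \<in> vanishing_ideal A F"
    have "a x = 0" if "x \<in> E" for x
    proof -
      have "evaluation x a = 0" using a that by (simp add: vanishing_ideal_def gelfand_transform_def E_def)
      then show ?thesis using a by (simp add: evaluation_apply vanishing_ideal_def)
    qed
    then show "a \<in> vanishing_on A E" using a by (simp add: vanishing_on_def vanishing_ideal_def)
  qed
  also have "\<dots> \<subseteq> closure (locally_vanishing_on A \<Gamma> E)"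
    using syn \<open>closed E\<close> by (simp add: synthesis_on_def E_def)
  also have "\<dots> \<subseteq> closure (nhd_vanishing_ideal A F)"
  proof (rule closure_mono, rule subsetI)
    fix a assume "a \<in> locally_vanishing_on A \<Gamma> E"
    then obtain V where V: "a \<in> A" "open V" "E \<subseteq> V" "\<And>x. x \<in> \<Gamma> \<Longrightarrow> x \<in> V \<Longrightarrow> a x = 0"
      by (auto simp: locally_vanishing_on_def)
    define U where "U = characters A - evaluation ` (\<Gamma> - V)"
    have "closedin (gelfand_topology A) (evaluation ` (\<Gamma> - V))"
      using cG V(2) by (intro closedin_evaluation_image closed_Diff)
    then have "openin (gelfand_topology A) U"
      unfolding U_def using openin_diff[OF openin_topspace] by (metis topspace_gelfand_topology)
    moreover have "F \<subseteq> U"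
      using Fsub V(3) by (auto simp: U_def E_def)
    moreover have "\<phi> a = 0" if \<phi>: "\<phi> \<in> U" for \<phi>
    proof -
      obtain x where x: "x \<in> \<Gamma>" "\<phi> = evaluation x"
        using character_eq_evaluation[OF bd syn, of \<phi>] \<phi> by (auto simp: U_def)
      with \<phi> have "x \<in> V" by (auto simp: U_def)
      with x V show ?thesis by (simp add: evaluation_apply)
    qed
    ultimately show "a \<in> nhd_vanishing_ideal A F"
      using V(1) by (auto simp: nhd_vanishing_ideal_def gelfand_transform_def)
  qed
  finally show "vanishing_ideal A F \<subseteq> closure (nhd_vanishing_ideal A F)" .
qed

section \<open>Synthesis makes the topology Hausdorff\<close>

definition zero_set :: "('x \<Rightarrow>\<^sub>C complex) set \<Rightarrow> 'x set" where
  "zero_set I = {x. \<forall>b\<in>I. apply_bcontfun b x = 0}"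

lemma ideal_ex_unit_on:
  assumes syn: "synthesis_on A UNIV" and I: "I \<in> closed_ideals A" and C: "closed C" "C \<inter> zero_set I = {}"
  shows "\<exists>e\<in>I. \<forall>x\<in>C. e x = 1"
  using closed_idealsD[OF I] C
  by (intro ex_unit_on_compact[OF _ _ _ _ syn]) (auto simp: zero_set_def)

text \<open>
  If \<open>j\<close> vanishes on a neighbourhood \<open>V\<close> of the zero set and \<open>e \<in> I\<close> is \<open>1\<close> off \<open>V\<close>, then \<open>j = j e \<in> I\<close>;
  by synthesis such \<open>j\<close> are dense in the vanishing ideal.
\<close>

lemma closed_ideal_eq_vanishing_on_zero_set:
  assumes syn: "synthesis_on A UNIV" and I: "I \<in> closed_ideals A"
  shows "I = vanishing_on A (zero_set I)"
proof
  show "I \<subseteq> vanishing_on A (zero_set I)" using closed_idealsD(1)[OF I] by (auto simp: vanishing_on_def zero_set_def)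
  have "zero_set I = (\<Inter>b\<in>I. {x. apply_bcontfun b x = 0})" by (auto simp: zero_set_def)
  moreover have "closed {x. apply_bcontfun b x = 0}" for b :: "'x \<Rightarrow>\<^sub>C complex"
    by (intro closed_Collect_eq continuous_intros) auto
  ultimately have "closed (zero_set I)" by (simp add: closed_INT)
  then have "vanishing_on A (zero_set I) \<subseteq> closure (locally_vanishing_on A UNIV (zero_set I))"
    using syn by (simp add: synthesis_on_def)
  also have "\<dots> \<subseteq> I"
  proof (rule closure_minimal[OF _ closed_idealsD(2)[OF I]])
    show "locally_vanishing_on A UNIV (zero_set I) \<subseteq> I"
    proof
      fix j assume "j \<in> locally_vanishing_on A UNIV (zero_set I)"
      then obtain V where V: "j \<in> A" "open V" "zero_set I \<subseteq> V" "\<And>x. x \<in> V \<Longrightarrow> j x = 0"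
        by (auto simp: locally_vanishing_on_def)
      obtain e where e: "e \<in> I" "\<And>x. x \<in> - V \<Longrightarrow> e x = 1"
        using ideal_ex_unit_on[OF syn I, of "- V"] V(2,3) by auto
      have "j * e = j"
      proof (rule bcontfun_eqI)
        show "(j * e) x = j x" for x using V(4)[of x] e(2)[of x] by (cases "x \<in> V") auto
      qed
      then show "j \<in> I" using closed_idealsD(6)[OF I V(1) e(1)] by simp
    qed
  qed
  finally show "vanishing_on A (zero_set I) \<subseteq> I" .
qed

text \<open>
  The ideal of functions vanishing at \<open>x\<close> has no other zero, so it contains a function that is \<open>1\<close> off
  \<open>V\<close>; subtract it from \<open>1\<close>.
\<close>

lemma ex_bump:
  assumes syn: "synthesis_on A UNIV" and V: "open V" "x \<in> V"
  shows "\<exists>c\<in>A. c x = 1 \<and> (\<forall>y. y \<notin> V \<longrightarrow> c y = 0)"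
proof -
  let ?K = "closure (locally_vanishing_on A UNIV {x})"
  have "vanishing_on A {x} \<subseteq> ?K" using syn by (simp add: synthesis_on_def)
  moreover have "?K \<subseteq> vanishing_on A {x}"
    using closed_idealsD(2)[OF vanishing_on_closed_ideal[of "{x}"]]
    by (intro closure_minimal) (auto simp: vanishing_on_def locally_vanishing_on_def)
  ultimately have eq: "?K = vanishing_on A {x}" by blast
  have "- V \<inter> zero_set (vanishing_on A {x}) = {}"
  proof -
    have "y \<notin> zero_set (vanishing_on A {x})" if "y \<notin> V" for y
    proof -
      obtain f where f: "f \<in> A" "f x \<noteq> f y" using separates[of x y] \<open>y \<notin> V\<close> V by blast
      have "f - const_bcontfun (f x) \<in> vanishing_on A {x}" using f by (auto simp: vanishing_on_def intro: mem_intros)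
      moreover have "(f - const_bcontfun (f x)) y \<noteq> 0" using f by auto
      ultimately show ?thesis unfolding zero_set_def by blast
    qed
    then show ?thesis by blast
  qed
  then obtain e where e: "e \<in> vanishing_on A {x}" "\<forall>y\<in>- V. e y = 1"
    using ideal_ex_unit_on[OF syn vanishing_on_closed_ideal, of "- V" "{x}"] V by auto
  then show ?thesis
    by (intro bexI[of _ "1 - e"]) (auto simp: vanishing_on_def intro: mem_intros)
qed

text \<open>
  The open sets are \<open>{K. \<parallel>e + K\<parallel> < 1/2}\<close>, where \<open>e \<in> I\<close> is \<open>1\<close> on a neighbourhood \<open>V\<close> of \<open>x\<close>, and
  \<open>{K. c \<notin> K}\<close>, where \<open>c\<close> is a bump inside \<open>V\<close> at \<open>x\<close>. If \<open>k \<in> K\<close> and \<open>\<parallel>e + k\<parallel> < 1/2\<close>, then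
  \<open>\<bar>k\<bar> > 1/2\<close> on \<open>V\<close>; a unit of \<open>K\<close> on \<open>{\<bar>k\<bar> \<ge> 1/2}\<close> fixes \<open>c\<close> under multiplication, so \<open>c \<in> K\<close>.
\<close>

lemma separate_ideals:
  assumes syn: "synthesis_on A UNIV" and I: "I \<in> closed_ideals A" and J: "J \<in> closed_ideals A"
    and x: "x \<in> zero_set J" "x \<notin> zero_set I"
  shows "\<exists>U W. openin (tau_r A) U \<and> openin (tau_r A) W \<and> I \<in> U \<and> J \<in> W \<and> disjnt U W"
proof -
  have "\<exists>e\<in>I. \<exists>V. open V \<and> x \<in> V \<and> (\<forall>y\<in>UNIV \<inter> V. e y = 1)"
    by (rule ex_local_unit[OF _ _ syn]) (use closed_idealsD[OF I] x(2) in \<open>auto simp: zero_set_def\<close>)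
  then obtain e V where e: "e \<in> I" "open V" "x \<in> V" "\<And>y. y \<in> V \<Longrightarrow> e y = 1" by auto
  have eA: "e \<in> A" using e(1) closed_idealsD(1)[OF I] by blast
  obtain c where c: "c \<in> A" "c x = 1" "\<And>y. y \<notin> V \<Longrightarrow> c y = 0" using ex_bump[OF syn e(2,3)] by blast
  let ?U = "{K \<in> closed_ideals A. quotient_norm e K < 1/2}" and ?W = "{K \<in> closed_ideals A. c \<notin> K}"
  have "c \<in> K" if K: "K \<in> ?U" for K
  proof -
    have Kc: "K \<in> closed_ideals A" using K by simp
    then obtain k where k: "k \<in> K" "norm (e + k) < 1/2"
      using K quotient_norm_less_iff[OF closed_idealsD(4)[OF Kc]] by blast
    define C where "C = {y. 1/2 \<le> norm (k y)}"
    have "closed C" unfolding C_def by (intro closed_Collect_le continuous_intros) auto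
    moreover have "C \<inter> zero_set K = {}" using k(1) by (auto simp: C_def zero_set_def)
    ultimately obtain g where g: "g \<in> K" "\<forall>y\<in>C. g y = 1" using ideal_ex_unit_on[OF syn Kc] by blast
    have "V \<subseteq> C"
    proof
      fix y assume "y \<in> V"
      then have "norm (1 + k y) < 1/2" using norm_bounded[of "e + k" y] k(2) e(4) by simp
      moreover have "norm (1 :: complex) \<le> norm (1 + k y) + norm (k y)" using norm_triangle_ineq4[of "1 + k y" "k y"] by simp
      ultimately show "y \<in> C" by (simp add: C_def)
    qed
    have "c * g = c"
    proof (rule bcontfun_eqI)
      show "(c * g) y = c y" for y using c(3)[of y] g(2) \<open>V \<subseteq> C\<close> by (cases "y \<in> V") auto
    qed
    then show ?thesis using closed_idealsD(6)[OF Kc c(1) g(1)] by simp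
  qed
  then have "disjnt ?U ?W" unfolding disjnt_def by blast
  moreover have "quotient_norm e I \<le> norm (e + - e)" using ideal_uminus[OF I e(1)] by (rule quotient_norm_le)
  then have "I \<in> ?U" using I by simp
  moreover have "J \<in> ?W" using J c(2) x(1) by (auto simp: zero_set_def)
  ultimately show ?thesis
    using openin_tau_r_quotient_norm_less[OF eA] openin_tau_r_not_mem[OF c(1)] by blast
qed

lemma Hausdorff_if_synthesis:
  assumes syn: "synthesis_on A UNIV"
  shows "Hausdorff_space (tau_r A)"
  unfolding Hausdorff_space_def
proof (intro allI impI)
  fix I J assume "I \<in> topspace (tau_r A) \<and> J \<in> topspace (tau_r A) \<and> I \<noteq> J"
  then have IJ: "I \<in> closed_ideals A" "J \<in> closed_ideals A" "I \<noteq> J"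
    using topspace_tau_r one_mem by auto
  then have "zero_set I \<noteq> zero_set J"
    using closed_ideal_eq_vanishing_on_zero_set[OF syn] by metis
  then consider x where "x \<in> zero_set J" "x \<notin> zero_set I" | x where "x \<in> zero_set I" "x \<notin> zero_set J" by blast
  then show "\<exists>U V. openin (tau_r A) U \<and> openin (tau_r A) V \<and> I \<in> U \<and> J \<in> V \<and> disjnt U V"
  proof cases
    case 1
    then show ?thesis by (rule separate_ideals[OF syn IJ(1,2)])
  next
    case 2
    then obtain U W where "openin (tau_r A) U" "openin (tau_r A) W" "J \<in> U" "I \<in> W" "disjnt U W"
      using separate_ideals[OF syn IJ(2,1)] by blast
    then show ?thesis by (intro exI[of _ W] exI[of _ U]) (auto simp: disjnt_sym)
  qed
qed

section \<open>The Shilov boundary\<close>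

definition peaks_in :: "'x set \<Rightarrow> bool" where
  "peaks_in V \<longleftrightarrow> (\<exists>f\<in>A. norm f = 1 \<and> (\<exists>y. norm (apply_bcontfun f y) = 1) \<and> (\<forall>z. z \<notin> V \<longrightarrow> norm (apply_bcontfun f z) < 1))"

text \<open>
  This is the smallest closed boundary. The description by peaking functions is chosen because it
  supplies peak sets inside every open set that meets the boundary.
\<close>

definition shilov_boundary :: "'x set" where
  "shilov_boundary = {x. \<forall>V. open V \<and> x \<in> V \<longrightarrow> peaks_in V}"

lemma closed_shilov_boundary: "closed shilov_boundary"
proof -
  have "- shilov_boundary = \<Union>{V. open V \<and> \<not> peaks_in V}"
    by (auto simp: shilov_boundary_def)
  then show ?thesis by (simp add: closed_def open_Union)
qed

lemma norm_attained:
  fixes f :: "'x \<Rightarrow>\<^sub>C complex"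
  assumes "closed E" "E \<noteq> {}"
  shows "\<exists>x\<in>E. \<forall>y\<in>E. norm (f y) \<le> norm (f x)"
  using continuous_attains_sup[OF compact_closed[OF assms(1)] assms(2), of "\<lambda>x. norm (f x)"]
  by (auto intro!: continuous_intros)

lemma closed_boundary_UNIV: "closed_boundary A UNIV"
  unfolding closed_boundary_def
proof (intro conjI ballI)
  fix f :: "'x \<Rightarrow>\<^sub>C complex"
  obtain x where x: "\<And>y. norm (f y) \<le> norm (f x)" using norm_attained[of UNIV f] by auto
  have "norm f \<le> norm (f x)" by (rule norm_bound) (rule x)
  with norm_bounded[of f x] show "\<exists>x\<in>UNIV. norm (f x) = norm f" by (metis UNIV_I antisym)
qed simp

lemma open_norm_less: "open {x. norm (f x) < r}"
  and open_norm_greater: "open {x. r < norm (f x)}" for f :: "'x \<Rightarrow>\<^sub>C complex"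
  by (auto intro!: open_Collect_less continuous_intros)

definition basic_nhd :: "('x \<Rightarrow>\<^sub>C complex) set \<Rightarrow> 'x set" where
  "basic_nhd H = {y. \<forall>h\<in>H. norm (apply_bcontfun h y) < 1}"

lemma open_basic_nhd:
  assumes "finite H"
  shows "open (basic_nhd H)"
proof -
  have "basic_nhd H = (\<Inter>h\<in>H. {y. norm (apply_bcontfun h y) < 1})" by (auto simp: basic_nhd_def)
  then show ?thesis using assms by (auto intro: open_norm_less)
qed

text \<open>
  On a compact space the topology is the weak topology of any separating family.
\<close>

lemma ex_basic_neighbourhood:
  assumes "open V" "x \<in> V"
  shows "\<exists>H. finite H \<and> H \<subseteq> A \<and> x \<in> basic_nhd H \<and> basic_nhd H \<subseteq> V"
proof -
  have "\<exists>h. h \<in> A \<and> h x = 0 \<and> 1 < norm (h y)" if "y \<in> - V" for y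
  proof -
    have "x \<noteq> y" using that assms by auto
    then obtain f where f: "f \<in> A" "f x \<noteq> f y" using separates by blast
    define h where "h = const_bcontfun (2 / (f y - f x)) * (f - const_bcontfun (f x))"
    have "h \<in> A" using f(1) unfolding h_def by (intro mem_intros)
    moreover have "h x = 0" by (simp add: h_def)
    moreover have "h y = 2" using f(2) unfolding h_def times_bcontfun_apply by (simp add: field_simps)
    ultimately show ?thesis by (intro exI[of _ h]) auto
  qed
  then obtain h where h: "\<And>y. y \<in> - V \<Longrightarrow> h y \<in> A \<and> h y x = 0 \<and> 1 < norm (h y y)" by metis
  obtain D where D: "D \<subseteq> - V" "finite D" "- V \<subseteq> (\<Union>y\<in>D. {z. 1 < norm (h y z)})"
    by (rule compactE_image[of "- V" "- V" "\<lambda>y. {z. 1 < norm (h y z)}"])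
      (use h assms in \<open>auto intro: compact_closed open_norm_greater\<close>)
  show ?thesis
  proof (intro exI[of _ "h ` D"] conjI)
    show "finite (h ` D)" "h ` D \<subseteq> A" using D h by auto
    show "x \<in> basic_nhd (h ` D)" using D(1) h by (auto simp: basic_nhd_def)
    show "basic_nhd (h ` D) \<subseteq> V"
    proof (rule ccontr)
      assume "\<not> ?thesis"
      then obtain y where y: "y \<in> basic_nhd (h ` D)" "y \<in> - V" by blast
      then obtain d where "d \<in> D" "1 < norm (h d y)" using D(3) by blast
      with y(1) show False by (auto simp: basic_nhd_def dest!: bspec[of _ _ d])
    qed
  qed
qed

text \<open>
  If \<open>f\<close> of norm \<open>1\<close> did not attain its norm on \<open>E - V\<close>, where \<open>V\<close> is the basic neighbourhood, then a high
  power \<open>g\<close> of \<open>f\<close> would be so small on \<open>E - V\<close> that \<open>\<bar>g h\<bar> < 1\<close> on \<open>E\<close> for all \<open>h \<in> H\<close>: on \<open>V\<close> because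
  \<open>\<bar>h\<bar> < 1\<close>, elsewhere because \<open>\<bar>g\<bar>\<close> is small. As \<open>E\<close> is a boundary, \<open>\<bar>g h\<bar> < 1\<close> everywhere, so \<open>\<bar>h\<bar> < 1\<close>
  wherever \<open>\<bar>g\<bar> = 1\<close>. Thus \<open>g\<close> would peak in \<open>V\<close>.
\<close>

lemma closed_boundary_remove:
  assumes E: "closed_boundary A E" and H: "finite H" "H \<subseteq> A"
    and np: "\<not> peaks_in (basic_nhd H)"
  shows "closed_boundary A (E - basic_nhd H)"
proof -
  define V where "V = basic_nhd H"
  have oV: "open V" using open_basic_nhd[OF H(1)] by (simp add: V_def)
  have cl: "closed (E - V)" using E oV by (auto simp: closed_boundary_def intro: closed_Diff)
  have "\<exists>x\<in>E - V. norm (f x) = norm f" if f: "f \<in> A" for f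
  proof (rule ccontr)
    assume no: "\<not> ?thesis"
    obtain x0 where x0: "norm (f x0) = norm f" using E f by (auto simp: closed_boundary_def)
    have less: "norm (f x) < norm f" if "x \<in> E - V" for x
      using no that norm_bounded[of f x] by (metis order_le_less)
    \<comment> \<open>For \<open>f = 0\<close> the set \<open>E - V\<close> is empty; then all \<open>h\<close> are below \<open>1\<close> in norm and the constant \<open>1\<close> peaks in \<open>V\<close>.\<close>
    have f0: "norm f > 0"
    proof (rule ccontr)
      assume "\<not> norm f > 0"
      then have "f = 0" by simp
      have "E - V = {}" using less \<open>f = 0\<close> by force
      moreover have "\<exists>x\<in>E. norm ((1 :: 'x \<Rightarrow>\<^sub>C complex) x) = norm (1 :: 'x \<Rightarrow>\<^sub>C complex)"
        using one_mem by (rule closed_boundaryE[OF E]) blast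
      ultimately have "E \<subseteq> V" "E \<noteq> {}" by auto
      have "norm h < 1" if "h \<in> H" for h
      proof -
        from H(2) that have "h \<in> A" by blast
        then obtain x where "x \<in> E" "norm (h x) = norm h" by (rule closed_boundaryE[OF E])
        moreover from \<open>E \<subseteq> V\<close> \<open>x \<in> E\<close> have "x \<in> V" by blast
        then have "norm (h x) < 1" using that by (auto simp: V_def basic_nhd_def)
        ultimately show ?thesis by simp
      qed
      then have "V = UNIV" unfolding V_def basic_nhd_def by (auto intro: le_less_trans[OF norm_bounded])
      then have "peaks_in V"
        unfolding peaks_in_def using one_mem by (intro bexI[of _ 1]) auto
      then show False using np by (simp add: V_def)
    qed
    define g where "g = const_bcontfun (inverse (norm f)) * f"
    have gA: "g \<in> A" using f by (auto simp: g_def intro: mem_intros)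
    have gx: "norm (g x) = norm (f x) / norm f" for x
      using f0 by (simp add: g_def norm_mult norm_inverse divide_inverse)
    have g1: "norm (g x) \<le> 1" for x using norm_bounded[of f x] f0 by (simp add: gx)
    have "\<exists>\<delta><1. \<delta> \<ge> 0 \<and> (\<forall>x\<in>E - V. norm (g x) \<le> \<delta>)"
    proof (cases "E - V = {}")
      case True
      then show ?thesis by (intro exI[of _ 0]) auto
    next
      case False
      from norm_attained[OF cl this, of g] obtain x where "x \<in> E - V" "\<forall>y\<in>E - V. norm (g y) \<le> norm (g x)" by blast
      moreover have "norm (g x) < 1" using less[OF calculation(1)] f0 by (simp add: gx)
      ultimately show ?thesis by (intro exI[of _ "norm (g x)"]) auto
    qed
    then obtain \<delta> where \<delta>: "0 \<le> \<delta>" "\<delta> < 1" "\<And>x. x \<in> E - V \<Longrightarrow> norm (g x) \<le> \<delta>" by blast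
    define B where "B = 1 + (\<Sum>h\<in>H. norm h)"
    have "B > 0" unfolding B_def by (simp add: add_pos_nonneg sum_nonneg)
    have hB: "norm h < B" if "h \<in> H" for h
      using member_le_sum[of h H norm] that H by (auto simp: B_def)
    obtain m where m: "\<delta> ^ m < 1 / B" using real_arch_pow_inv[of "1 / B" \<delta>] \<open>B > 0\<close> \<delta>(2) by auto
    have small: "norm (g ^ m * h) < 1" if h: "h \<in> H" for h
    proof -
      have "norm ((g ^ m * h) x) < 1" if "x \<in> E" for x
      proof (cases "x \<in> V")
        case True
        have "norm (g x) ^ m * norm (h x) \<le> 1 * norm (h x)"
          using g1[of x] by (intro mult_right_mono power_le_one) auto
        with True h show ?thesis by (auto simp: V_def basic_nhd_def norm_mult norm_power)
      next
        case False
        then have "norm (g x) ^ m * norm (h x) \<le> \<delta> ^ m * B"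
          using \<delta> that hB[OF h] norm_bounded[of h x] by (intro mult_mono power_mono) auto
        also have "\<dots> < 1" using m \<open>B > 0\<close> by (simp add: field_simps)
        finally show ?thesis by (simp add: norm_mult norm_power)
      qed
      moreover have "g ^ m * h \<in> A" using gA H h by (auto intro: mem_intros)
      then obtain x where "x \<in> E" "norm ((g ^ m * h) x) = norm (g ^ m * h)"
        by (rule closed_boundaryE[OF E])
      ultimately show ?thesis by metis
    qed
    have gm1: "norm ((g ^ m) x) \<le> 1" for x using g1[of x] by (simp add: norm_power power_le_one)
    have gmx0: "norm ((g ^ m) x0) = 1" using f0 by (simp add: norm_power gx x0)
    have "norm (g ^ m) = 1"
      using gmx0 norm_bounded[of "g ^ m" x0] norm_bound[of "g ^ m" 1, OF gm1] by linarith
    moreover have "norm ((g ^ m) z) < 1" if "z \<notin> V" for z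
    proof (rule ccontr)
      assume "\<not> ?thesis"
      then have "norm ((g ^ m) z) = 1" using gm1[of z] by simp
      then have "norm (h z) < 1" if "h \<in> H" for h
        using small[OF that] norm_bounded[of "g ^ m * h" z] by (simp add: norm_mult)
      then show False using \<open>z \<notin> V\<close> by (simp add: V_def basic_nhd_def)
    qed
    ultimately have "peaks_in V"
      unfolding peaks_in_def using gA gmx0 by (intro bexI[of _ "g ^ m"]) (auto intro: mem_intros)
    then show False using np by (simp add: V_def)
  qed
  then show ?thesis using cl by (auto simp: closed_boundary_def V_def)
qed

text \<open>
  If \<open>f\<close> missed its norm on the Shilov boundary, the compact set where \<open>f\<close> attains it would be covered
  by finitely many basic neighbourhoods in which no function peaks. Removing these from the whole space one
  after the other leaves a boundary, on which \<open>f\<close> must attain its norm: a contradiction.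
\<close>

lemma closed_boundary_shilov: "closed_boundary A shilov_boundary"
  unfolding closed_boundary_def
proof (intro conjI ballI closed_shilov_boundary)
  fix f assume f: "f \<in> A"
  show "\<exists>x\<in>shilov_boundary. norm (f x) = norm f"
  proof (rule ccontr)
    assume no: "\<not> ?thesis"
    define M where "M = {x. norm (f x) = norm f}"
    have "closed M" unfolding M_def by (intro closed_Collect_eq continuous_intros) auto
    have "\<exists>H. finite H \<and> H \<subseteq> A \<and> x \<in> basic_nhd H \<and> \<not> peaks_in (basic_nhd H)" if "x \<in> M" for x
    proof -
      have "x \<notin> shilov_boundary" using that no by (auto simp: M_def)
      then obtain V where V: "open V" "x \<in> V" "\<not> peaks_in V" by (auto simp: shilov_boundary_def)
      obtain H where H: "finite H" "H \<subseteq> A" "x \<in> basic_nhd H" "basic_nhd H \<subseteq> V"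
        using ex_basic_neighbourhood[OF V(1,2)] by auto
      have "\<not> peaks_in (basic_nhd H)" using V(3) H(4) unfolding peaks_in_def by blast
      then show ?thesis using H by blast
    qed
    then obtain H where H: "\<And>x. x \<in> M \<Longrightarrow> finite (H x) \<and> H x \<subseteq> A \<and> x \<in> basic_nhd (H x) \<and> \<not> peaks_in (basic_nhd (H x))"
      by metis
    obtain D where D: "D \<subseteq> M" "finite D" "M \<subseteq> (\<Union>x\<in>D. basic_nhd (H x))"
      by (rule compactE_image[OF compact_closed[OF \<open>closed M\<close>], of M "\<lambda>x. basic_nhd (H x)"]) (use H open_basic_nhd in auto)
    have "closed_boundary A (UNIV - (\<Union>x\<in>D. basic_nhd (H x)))"
      using D(2,1)
    proof (induction D rule: finite_induct)
      case empty
      show ?case using closed_boundary_UNIV by simp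
    next
      case (insert x D)
      have "closed_boundary A (UNIV - (\<Union>x\<in>D. basic_nhd (H x)) - basic_nhd (H x))"
        using insert H[of x] closed_boundary_remove[of "UNIV - (\<Union>x\<in>D. basic_nhd (H x))" "H x"]
        by auto
      also have "UNIV - (\<Union>x\<in>D. basic_nhd (H x)) - basic_nhd (H x) = UNIV - (\<Union>x\<in>insert x D. basic_nhd (H x))" by auto
      finally show ?case .
    qed
    from closed_boundaryE[OF this f]
    obtain x where "x \<notin> (\<Union>x\<in>D. basic_nhd (H x))" "norm (f x) = norm f" by blast
    with D(3) show False by (auto simp: M_def)
  qed
qed

text \<open>
  Rotate a function peaking in \<open>V\<close> so that it takes the value \<open>1\<close> at a point where its modulus is \<open>1\<close>;
  its mean with \<open>1\<close> then has modulus \<open>1\<close> only where it equals \<open>1\<close>.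
\<close>

lemma ex_peaking_function:
  assumes x: "x \<in> shilov_boundary" and V: "open V" "x \<in> V"
  shows "\<exists>g\<in>A. (\<exists>y\<in>shilov_boundary. g y = 1) \<and> (\<forall>z. g z = 1 \<longrightarrow> z \<in> V) \<and> (\<forall>z. g z \<noteq> 1 \<longrightarrow> norm (g z) < 1)"
proof -
  obtain f where f: "f \<in> A" "norm f = 1" "\<And>z. z \<notin> V \<Longrightarrow> norm (f z) < 1"
    using x V by (auto simp: shilov_boundary_def peaks_in_def)
  obtain y where y: "y \<in> shilov_boundary" "norm (f y) = 1"
    using closed_boundaryE[OF closed_boundary_shilov f(1)] f(2) by metis
  define h where "h = const_bcontfun (cnj (f y)) * f"
  define g where "g = const_bcontfun (1/2) * (1 + h)"
  have gA: "g \<in> A" using f by (auto simp: g_def h_def intro: mem_intros)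
  have gz: "g z = (1 + h z) / 2" for z by (simp add: g_def)
  have hz: "norm (h z) = norm (f z)" for z by (simp add: h_def norm_mult y)
  have hy: "h y = 1" using complex_norm_square[of "f y"] y(2) by (simp add: h_def mult.commute)
  have h1: "norm (h z) \<le> 1" for z using norm_bounded[of f z] f by (simp add: hz)
  have gy: "g y = 1" by (simp add: gz hy)
  have gV: "z \<in> V" if "g z = 1" for z
  proof -
    have "h z = 1" using that by (simp add: gz field_simps)
    then show ?thesis using hz[of z] f(3)[of z] by force
  qed
  have gl: "norm (g z) < 1" if "g z \<noteq> 1" for z
  proof (rule ccontr)
    assume "\<not> ?thesis"
    then have "norm (1 + h z) \<ge> 2" by (simp add: gz norm_divide)
    with h1[of z] norm_triangle_ineq[of 1 "h z"] have n: "norm (1 + h z) = norm (1::complex) + norm (h z)" "norm (h z) = 1"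
      by auto
    from n(1) have "norm (1::complex) *\<^sub>R h z = norm (h z) *\<^sub>R 1" by (subst (asm) norm_triangle_eq)
    with n(2) have "h z = 1" by simp
    with that show False by (simp add: gz)
  qed
  show ?thesis
  proof (rule bexI[OF _ gA], intro conjI allI impI)
    show "\<exists>y\<in>shilov_boundary. g y = 1" using gy y(1) by (rule bexI)
  qed (fact gV gl)+
qed

section \<open>Approximate peak sets\<close>

text \<open>
  The bound \<open>1 + \<epsilon>\<close> on \<open>\<Gamma>\<close>, in place of the bound \<open>1\<close> that a peak set allows, makes the notion stable
  under disjoint unions.
\<close>

definition approximate_peak_set :: "'x set \<Rightarrow> 'x set \<Rightarrow> bool" where
  "approximate_peak_set \<Gamma> E \<longleftrightarrow> E \<subseteq> \<Gamma> \<and>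
     (\<forall>V \<epsilon>. open V \<longrightarrow> E \<subseteq> V \<longrightarrow> \<epsilon> > 0 \<longrightarrow>
        (\<exists>u\<in>A. (\<forall>x\<in>E. apply_bcontfun u x = 1) \<and> (\<forall>x\<in>\<Gamma>. norm (apply_bcontfun u x) \<le> 1 + \<epsilon>) \<and>
           (\<forall>x\<in>\<Gamma> - V. norm (apply_bcontfun u x) \<le> \<epsilon>)))"

lemma approximate_peak_setE:
  assumes "approximate_peak_set \<Gamma> E" "open V" "E \<subseteq> V" "\<epsilon> > 0"
  obtains u where "u \<in> A" "\<And>x. x \<in> E \<Longrightarrow> u x = 1" "\<And>x. x \<in> \<Gamma> \<Longrightarrow> norm (u x) \<le> 1 + \<epsilon>"
    "\<And>x. x \<in> \<Gamma> \<Longrightarrow> x \<notin> V \<Longrightarrow> norm (u x) \<le> \<epsilon>"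
  using assms unfolding approximate_peak_set_def by (metis DiffI)

lemma approximate_peak_set_empty: "approximate_peak_set \<Gamma> {}"
  unfolding approximate_peak_set_def by (auto intro!: bexI[of _ 0] zero_mem)

text \<open>
  With \<open>u1\<close> and \<open>u2\<close> small off disjoint neighbourhoods, at each point one of them is small, so
  \<open>u1 + u2 - u1 * u2 = 1 - (1 - u1) * (1 - u2)\<close> is essentially bounded by \<open>1\<close>.
\<close>

lemma approximate_peak_set_Un:
  assumes E1: "approximate_peak_set \<Gamma> E1" and E2: "approximate_peak_set \<Gamma> E2"
    and W: "open W1" "open W2" "W1 \<inter> W2 = {}" "E1 \<subseteq> W1" "E2 \<subseteq> W2"
  shows "approximate_peak_set \<Gamma> (E1 \<union> E2)"
  unfolding approximate_peak_set_def
proof (intro conjI allI impI)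
  show "E1 \<union> E2 \<subseteq> \<Gamma>" using E1 E2 by (simp add: approximate_peak_set_def)
  fix V and \<epsilon> :: real
  assume V: "open V" "E1 \<union> E2 \<subseteq> V" and \<epsilon>: "\<epsilon> > 0"
  define \<delta> where "\<delta> = min 1 (\<epsilon> / 4)"
  have \<delta>: "\<delta> > 0" "\<delta> \<le> 1" "4 * \<delta> \<le> \<epsilon>" using \<epsilon> by (auto simp: \<delta>_def)
  have \<delta>2: "\<delta> * \<delta> \<le> \<delta>" using \<delta> mult_left_le[of \<delta> \<delta>] by simp
  obtain u1 where u1: "u1 \<in> A" "\<And>x. x \<in> E1 \<Longrightarrow> u1 x = 1" "\<And>x. x \<in> \<Gamma> \<Longrightarrow> norm (u1 x) \<le> 1 + \<delta>"
    "\<And>x. x \<in> \<Gamma> \<Longrightarrow> x \<notin> V \<inter> W1 \<Longrightarrow> norm (u1 x) \<le> \<delta>"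
    by (rule approximate_peak_setE[OF E1, of "V \<inter> W1" \<delta>]) (use V W \<delta> in auto)
  obtain u2 where u2: "u2 \<in> A" "\<And>x. x \<in> E2 \<Longrightarrow> u2 x = 1" "\<And>x. x \<in> \<Gamma> \<Longrightarrow> norm (u2 x) \<le> 1 + \<delta>"
    "\<And>x. x \<in> \<Gamma> \<Longrightarrow> x \<notin> V \<inter> W2 \<Longrightarrow> norm (u2 x) \<le> \<delta>"
    by (rule approximate_peak_setE[OF E2, of "V \<inter> W2" \<delta>]) (use V W \<delta> in auto)
  define u where "u = u1 + u2 - u1 * u2"
  have le: "norm (u x) \<le> norm (u1 x) + norm (u2 x) + norm (u1 x) * norm (u2 x)" for x
    using norm_triangle_ineq4[of "u1 x + u2 x" "u1 x * u2 x"] norm_triangle_ineq[of "u1 x" "u2 x"]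
    by (simp add: u_def norm_mult)
  have both: "norm (u x) \<le> 3 * \<delta>" if "norm (u1 x) \<le> \<delta>" "norm (u2 x) \<le> \<delta>" for x
  proof -
    have "norm (u1 x) * norm (u2 x) \<le> \<delta> * \<delta>" using that \<delta> by (intro mult_mono) auto
    then show ?thesis using le[of x] that \<delta>2 by linarith
  qed
  have one: "norm (u x) \<le> 1 + 4 * \<delta>"
    if "norm (u1 x) \<le> 1 + \<delta> \<and> norm (u2 x) \<le> \<delta> \<or> norm (u1 x) \<le> \<delta> \<and> norm (u2 x) \<le> 1 + \<delta>" for x
  proof -
    have "norm (u1 x) * norm (u2 x) \<le> (1 + \<delta>) * \<delta>"
      using that
    proof
      assume "norm (u1 x) \<le> 1 + \<delta> \<and> norm (u2 x) \<le> \<delta>"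
      then show ?thesis using \<delta> by (intro mult_mono) auto
    next
      assume "norm (u1 x) \<le> \<delta> \<and> norm (u2 x) \<le> 1 + \<delta>"
      then have "norm (u1 x) * norm (u2 x) \<le> \<delta> * (1 + \<delta>)" using \<delta> by (intro mult_mono) auto
      then show ?thesis by (simp add: mult.commute)
    qed
    then show ?thesis using le[of x] that \<delta>2 by (auto simp: algebra_simps)
  qed
  show "\<exists>u\<in>A. (\<forall>x\<in>E1 \<union> E2. apply_bcontfun u x = 1) \<and> (\<forall>x\<in>\<Gamma>. norm (apply_bcontfun u x) \<le> 1 + \<epsilon>) \<and>
      (\<forall>x\<in>\<Gamma> - V. norm (apply_bcontfun u x) \<le> \<epsilon>)"
  proof (intro bexI[of _ u] conjI ballI)
    show "u \<in> A" using u1 u2 by (auto simp: u_def intro: mem_intros)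
    fix x
    show "u x = 1" if "x \<in> E1 \<union> E2" using that u1(2)[of x] u2(2)[of x] by (auto simp: u_def)
    show "norm (u x) \<le> 1 + \<epsilon>" if x: "x \<in> \<Gamma>"
    proof -
      have "norm (u1 x) \<le> \<delta> \<or> norm (u2 x) \<le> \<delta>" using u1(4)[OF x] u2(4)[OF x] W(3) by blast
      then show ?thesis using one[of x] u1(3)[OF x] u2(3)[OF x] \<delta>(3) by auto
    qed
    show "norm (u x) \<le> \<epsilon>" if "x \<in> \<Gamma> - V"
      using both[of x] u1(4)[of x] u2(4)[of x] that \<delta> by auto
  qed
qed

lemma quotient_norm_ge: "x \<in> E \<Longrightarrow> norm (a x) \<le> quotient_norm a (vanishing_on A E)"
  for a :: "'x \<Rightarrow>\<^sub>C complex"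
  unfolding quotient_norm_def
proof (rule cINF_greatest)
  show "vanishing_on A E \<noteq> {}" by (rule closed_idealsD(4)[OF vanishing_on_closed_ideal])
  fix b assume "x \<in> E" "b \<in> vanishing_on A E"
  then show "norm (a x) \<le> norm (a + b)" using norm_bounded[of "a + b" x] by (simp add: vanishing_on_def)
qed

text \<open>
  For \<open>u\<close> equal to \<open>1\<close> on \<open>E\<close> and small where \<open>\<bar>a\<bar>\<close> exceeds \<open>r + \<epsilon>\<close>, the function \<open>a * u\<close> represents the
  class of \<open>a\<close> and has norm close to \<open>r\<close>. Together with \<open>quotient_norm_ge\<close> this makes the quotient norm
  the supremum of \<open>\<bar>a\<bar>\<close> over \<open>E\<close>.
\<close>

lemma quotient_norm_approximate_peak_set_le:
  assumes bd: "closed_boundary A \<Gamma>" and E: "approximate_peak_set \<Gamma> E"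
    and a: "a \<in> A" and r: "0 \<le> r" "\<And>x. x \<in> E \<Longrightarrow> norm (a x) \<le> r"
  shows "quotient_norm a (vanishing_on A E) \<le> r"
proof (rule field_le_epsilon)
  fix \<delta> :: real assume \<delta>: "\<delta> > 0"
  \<comment> \<open>Chosen so that both \<open>(r + \<epsilon>) (1 + \<epsilon>)\<close> and \<open>\<parallel>a\<parallel> \<epsilon>\<close> are at most \<open>r + \<delta>\<close>.\<close>
  define \<epsilon> where "\<epsilon> = min 1 (\<delta> / (r + 2 + norm a))"
  have pos: "r + 2 + norm a > 0" using r(1) norm_ge_zero[of a] by linarith
  have \<epsilon>: "\<epsilon> > 0" "\<epsilon> \<le> 1" using \<delta> pos by (auto simp: \<epsilon>_def)
  have "\<epsilon> \<le> \<delta> / (r + 2 + norm a)" by (simp add: \<epsilon>_def)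
  then have eps: "\<epsilon> * (r + 2 + norm a) \<le> \<delta>" using pos by (simp add: field_simps)
  obtain u where u: "u \<in> A" "\<And>x. x \<in> E \<Longrightarrow> u x = 1" "\<And>x. x \<in> \<Gamma> \<Longrightarrow> norm (u x) \<le> 1 + \<epsilon>"
    "\<And>x. x \<in> \<Gamma> \<Longrightarrow> x \<notin> {x. norm (a x) < r + \<epsilon>} \<Longrightarrow> norm (u x) \<le> \<epsilon>"
    by (rule approximate_peak_setE[OF E open_norm_less[of a "r + \<epsilon>"] _ \<epsilon>(1)]) (use r(2) \<epsilon>(1) in force)+
  have small: "norm (a x * u x) \<le> r + \<delta>" if x: "x \<in> \<Gamma>" for x
  proof (cases "norm (a x) < r + \<epsilon>")
    case True
    then have "norm (a x) * norm (u x) \<le> (r + \<epsilon>) * (1 + \<epsilon>)" using u(3)[OF x] \<epsilon> r(1) by (intro mult_mono) auto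
    also have "\<dots> = r + \<epsilon> * (r + 1 + \<epsilon>)" by (simp add: algebra_simps)
    also have "\<epsilon> * (r + 1 + \<epsilon>) \<le> \<epsilon> * (r + 2 + norm a)" using \<epsilon> norm_ge_zero[of a]
      by (intro mult_left_mono; linarith)
    also note eps
    finally show ?thesis by (simp add: norm_mult)
  next
    case False
    then have "norm (a x) * norm (u x) \<le> norm a * \<epsilon>" using u(4)[OF x] by (intro mult_mono norm_bounded) auto
    also have "\<dots> = \<epsilon> * norm a" by simp
    also have "\<dots> \<le> \<epsilon> * (r + 2 + norm a)" using \<epsilon> r(1) by (intro mult_left_mono) auto
    also note eps
    finally show ?thesis using r(1) by (simp add: norm_mult)
  qed
  have "a * u - a \<in> vanishing_on A E" using a u(1,2) by (auto simp: vanishing_on_def intro: mem_intros)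
  then have "quotient_norm a (vanishing_on A E) \<le> norm (a + (a * u - a))" by (rule quotient_norm_le)
  also have "\<dots> = norm (a * u)" by simp
  also obtain x where "x \<in> \<Gamma>" "norm ((a * u) x) = norm (a * u)"
    by (rule closed_boundaryE[OF bd mult_mem[OF a u(1)]])
  then have "norm (a * u) \<le> r + \<delta>" using small[of x] by simp
  finally show "quotient_norm a (vanishing_on A E) \<le> r + \<delta>" .
qed

text \<open>
  For a peak set, the powers of the peaking function are the required \<open>u\<close>.
\<close>

lemma ex_small_approximate_peak_set:
  assumes x: "x \<in> shilov_boundary" and V: "open V" "x \<in> V"
  shows "\<exists>P\<subseteq>V. P \<noteq> {} \<and> approximate_peak_set shilov_boundary P"
proof -
  obtain g where g: "g \<in> A" "\<exists>y\<in>shilov_boundary. g y = 1" "\<And>z. g z = 1 \<Longrightarrow> z \<in> V" "\<And>z. g z \<noteq> 1 \<Longrightarrow> norm (g z) < 1"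
    using ex_peaking_function[OF x V] by blast
  define P where "P = {z \<in> shilov_boundary. g z = 1}"
  have g1: "norm (g z) \<le> 1" for z using g(4)[of z] by (cases "g z = 1") auto
  have "approximate_peak_set shilov_boundary P"
    unfolding approximate_peak_set_def
  proof (intro conjI allI impI)
    show "P \<subseteq> shilov_boundary" by (auto simp: P_def)
    fix U and \<epsilon> :: real assume U: "open U" "P \<subseteq> U" and \<epsilon>: "\<epsilon> > 0"
    have cl: "closed (shilov_boundary - U)" using closed_shilov_boundary U(1) by (rule closed_Diff)
    have "\<exists>q. 0 \<le> q \<and> q < 1 \<and> (\<forall>z\<in>shilov_boundary - U. norm (g z) \<le> q)"
    proof (cases "shilov_boundary - U = {}")
      case True
      then show ?thesis by (intro exI[of _ 0]) auto
    next
      case False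
      then obtain z where z: "z \<in> shilov_boundary - U" "\<forall>y\<in>shilov_boundary - U. norm (g y) \<le> norm (g z)"
        using norm_attained[OF cl, of g] by blast
      then have "norm (g z) < 1" using U(2) by (intro g(4)) (auto simp: P_def)
      then show ?thesis using z(2) by (intro exI[of _ "norm (g z)"]) auto
    qed
    then obtain q where q: "0 \<le> q" "q < 1" "\<And>z. z \<in> shilov_boundary - U \<Longrightarrow> norm (g z) \<le> q" by blast
    obtain m where m: "q ^ m < \<epsilon>" using real_arch_pow_inv[OF \<epsilon> q(2)] by blast
    show "\<exists>u\<in>A. (\<forall>x\<in>P. apply_bcontfun u x = 1) \<and> (\<forall>x\<in>shilov_boundary. norm (apply_bcontfun u x) \<le> 1 + \<epsilon>) \<and>
        (\<forall>x\<in>shilov_boundary - U. norm (apply_bcontfun u x) \<le> \<epsilon>)"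
    proof (intro bexI[of _ "g ^ m"] conjI ballI)
      show "g ^ m \<in> A" using g(1) by (rule power_mem)
      fix z
      show "(g ^ m) z = 1" if "z \<in> P" using that by (simp add: P_def)
      show "norm ((g ^ m) z) \<le> 1 + \<epsilon>" using power_le_one[OF norm_ge_zero g1[of z], of m] \<epsilon> by (simp add: norm_power)
      show "norm ((g ^ m) z) \<le> \<epsilon>" if "z \<in> shilov_boundary - U"
      proof -
        have "norm (g z) ^ m \<le> q ^ m" using q(3)[OF that] by (rule power_mono) simp
        then show ?thesis using m by (simp add: norm_power)
      qed
    qed
  qed
  moreover have "P \<noteq> {}" "P \<subseteq> V" using g(2,3) by (auto simp: P_def)
  ultimately show ?thesis by blast
qed

text \<open>
  A finite set of pairs \<open>(x, a)\<close> is treated one pair at a time. If \<open>E\<close> does not yet serve \<open>(x, a)\<close>, then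
  \<open>\<bar>a\<bar> \<le> \<bar>a x\<bar> / 2\<close> on \<open>E\<close>, and a small peak set near \<open>x\<close>, where \<open>\<bar>a\<bar>\<close> is larger, is separated from \<open>E\<close> by
  a level set of \<open>\<bar>a\<bar>\<close> and can be added.
\<close>

lemma ex_rich_approximate_peak_set:
  assumes V: "open V" and Z: "finite Z" "Z \<subseteq> (shilov_boundary \<inter> V) \<times> A"
  shows "\<exists>E\<subseteq>V. approximate_peak_set shilov_boundary E \<and>
    (\<forall>(x, a)\<in>Z. apply_bcontfun a x \<noteq> 0 \<longrightarrow> (\<exists>y\<in>E. norm (apply_bcontfun a x) / 2 < norm (apply_bcontfun a y)))"
  using Z
proof (induction Z rule: finite_induct)
  case empty
  show ?case using approximate_peak_set_empty by (intro exI[of _ "{}"]) auto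
next
  case (insert z Z)
  obtain x a where z: "z = (x, a)" by (cases z)
  have x: "x \<in> shilov_boundary" "x \<in> V" using insert.prems by (auto simp: z)
  obtain E where E: "E \<subseteq> V" "approximate_peak_set shilov_boundary E"
    and EZ: "\<forall>(x, a)\<in>Z. apply_bcontfun a x \<noteq> 0 \<longrightarrow> (\<exists>y\<in>E. norm (apply_bcontfun a x) / 2 < norm (apply_bcontfun a y))"
    using insert.IH insert.prems by blast
  show ?case
  proof (cases "a x = 0 \<or> (\<exists>y\<in>E. norm (a x) / 2 < norm (a y))")
    case True
    then show ?thesis using E EZ by (intro exI[of _ E]) (auto simp: z)
  next
    case False
    then have nz: "a x \<noteq> 0" and Ea: "\<And>y. y \<in> E \<Longrightarrow> norm (a y) \<le> norm (a x) / 2" by force+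
    \<comment> \<open>Any level strictly between \<open>\<bar>a x\<bar> / 2\<close> and \<open>\<bar>a x\<bar>\<close> separates.\<close>
    define t where "t = norm (a x) * (3 / 4)"
    have t: "norm (a x) / 2 < t" "t < norm (a x)" using nz by (auto simp: t_def)
    obtain P where P: "P \<subseteq> V \<inter> {y. t < norm (a y)}" "P \<noteq> {}" "approximate_peak_set shilov_boundary P"
      using ex_small_approximate_peak_set[OF x(1), of "V \<inter> {y. t < norm (a y)}"] x(2) t V open_norm_greater[of t a]
      by auto
    have "approximate_peak_set shilov_boundary (E \<union> P)"
      by (rule approximate_peak_set_Un[OF E(2) P(3) open_norm_less[of a t] open_norm_greater[of t a]])
        (use P(1) Ea t in force)+
    moreover obtain y where "y \<in> P" using P(2) by blast
    then have "\<exists>y\<in>P. norm (a x) / 2 < norm (a y)" using P(1) t by force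
    ultimately show ?thesis
      using E(1) EZ P(1) by (intro exI[of _ "E \<union> P"]) (fastforce simp: z)
  qed
qed

section \<open>The Hausdorff property forces synthesis\<close>

text \<open>
  The filter follows approximate peak sets inside \<open>V\<close> that serve more and more pairs \<open>(x, a)\<close>; the third
  property says that they fill up \<open>\<Gamma> \<inter> V\<close>. The bound \<open>\<bar>a x\<bar> / 2\<close> does not depend on \<open>V\<close>, which matters
  when \<open>V\<close> shrinks.
\<close>

lemma ex_filter_of_peak_ideals:
  assumes V: "open V"
  shows "\<exists>G. G \<noteq> bot \<and>
    eventually (\<lambda>I. \<exists>E\<subseteq>V. approximate_peak_set shilov_boundary E \<and> I = vanishing_on A E) G \<and>
    (\<forall>x\<in>shilov_boundary \<inter> V. \<forall>a\<in>A. apply_bcontfun a x \<noteq> 0 \<longrightarrow> eventually (\<lambda>I. norm (apply_bcontfun a x) / 2 < quotient_norm a I) G)"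
proof -
  let ?B = "(shilov_boundary \<inter> V) \<times> A"
  let ?P = "\<lambda>(Z :: ('x \<times> ('x \<Rightarrow>\<^sub>C complex)) set) E. E \<subseteq> V \<and> approximate_peak_set shilov_boundary E \<and>
      (\<forall>(x, a)\<in>Z. apply_bcontfun a x \<noteq> 0 \<longrightarrow>
        (\<exists>y\<in>E. norm (apply_bcontfun a x) / 2 < norm (apply_bcontfun a y)))"
  define E where "E Z = (SOME E. ?P Z E)" for Z
  have E: "?P Z (E Z)" if "finite Z" "Z \<subseteq> ?B" for Z
    unfolding E_def by (rule someI_ex) (rule ex_rich_approximate_peak_set[OF V that])
  define G where "G = filtermap (\<lambda>Z. vanishing_on A (E Z)) (finite_subsets_at_top ?B)"
  have "G \<noteq> bot" by (simp add: G_def filtermap_bot_iff)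
  moreover have "eventually (\<lambda>I. \<exists>E\<subseteq>V. approximate_peak_set shilov_boundary E \<and> I = vanishing_on A E) G"
    unfolding G_def eventually_filtermap
    by (rule eventually_finite_subsets_at_top_weakI) (use E in blast)
  moreover have "eventually (\<lambda>I. norm (a x) / 2 < quotient_norm a I) G"
    if xa: "x \<in> shilov_boundary \<inter> V" "a \<in> A" "a x \<noteq> 0" for x a
    unfolding G_def eventually_filtermap eventually_finite_subsets_at_top
  proof (intro exI[of _ "{(x, a)}"] conjI allI impI)
    fix Z assume Z: "finite Z \<and> {(x, a)} \<subseteq> Z \<and> Z \<subseteq> ?B"
    then obtain y where "y \<in> E Z" "norm (a x) / 2 < norm (a y)" using E[of Z] xa by fastforce
    then show "norm (a x) / 2 < quotient_norm a (vanishing_on A (E Z))"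
      using quotient_norm_ge[of y "E Z" a] by linarith
  qed (use xa in auto)
  ultimately show ?thesis by blast
qed

text \<open>
  The filter of an iterated limit: first along \<open>G V\<close>, then as the open set \<open>V\<close> shrinks to \<open>F\<close>.
\<close>

definition shrinking_filter :: "'x set \<Rightarrow> ('x set \<Rightarrow> 'b filter) \<Rightarrow> 'b filter" where
  "shrinking_filter F G = (INF V0\<in>{V. open V \<and> F \<subseteq> V}. SUP V\<in>{V. open V \<and> F \<subseteq> V \<and> V \<subseteq> V0}. G V)"

lemma eventually_shrinking_filter:
  "eventually P (shrinking_filter F G) \<longleftrightarrow>
     (\<exists>V0. open V0 \<and> F \<subseteq> V0 \<and> (\<forall>V. open V \<longrightarrow> F \<subseteq> V \<longrightarrow> V \<subseteq> V0 \<longrightarrow> eventually P (G V)))"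
proof -
  let ?S = "\<lambda>V0. SUP V\<in>{V. open V \<and> F \<subseteq> V \<and> V \<subseteq> V0}. G V"
  have "eventually P (shrinking_filter F G) \<longleftrightarrow> (\<exists>V0\<in>{V. open V \<and> F \<subseteq> V}. eventually P (?S V0))"
    unfolding shrinking_filter_def
  proof (rule eventually_INF_base)
    show "{V. open V \<and> F \<subseteq> V} \<noteq> {}" using open_UNIV by blast
    fix a b assume "a \<in> {V. open V \<and> F \<subseteq> V}" "b \<in> {V. open V \<and> F \<subseteq> V}"
    then have "a \<inter> b \<in> {V. open V \<and> F \<subseteq> V}" by auto
    moreover have "?S (a \<inter> b) \<le> inf (?S a) (?S b)"
      by (intro inf_greatest SUP_subset_mono) auto
    ultimately show "\<exists>x\<in>{V. open V \<and> F \<subseteq> V}. ?S x \<le> inf (?S a) (?S b)" by (rule bexI[rotated])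
  qed
  also have "\<dots> \<longleftrightarrow> (\<exists>V0. open V0 \<and> F \<subseteq> V0 \<and> (\<forall>V\<in>{V. open V \<and> F \<subseteq> V \<and> V \<subseteq> V0}. eventually P (G V)))"
    unfolding eventually_Sup ball_simps Bex_def mem_Collect_eq conj_assoc ..
  finally show ?thesis unfolding Ball_def mem_Collect_eq imp_conjL .
qed

text \<open>
  The iterated limit \<open>?L\<close> of the peak ideals \<open>I(P)\<close> has two values. Directly, it is \<open>I(F)\<close>: functions
  vanishing on \<open>F\<close> are small on all \<open>P \<subseteq> V\<close>, while a function that is nonzero at \<open>x \<in> F\<close> keeps the lower
  bound \<open>\<bar>b x\<bar> / 2\<close> throughout. Limit by limit, it is the closure of \<open>J(F)\<close>: an open set containing that
  closure contains \<open>I(\<Gamma> \<inter> V)\<close> for all small \<open>V\<close>, hence eventually \<open>I(P)\<close> for each of these \<open>V\<close>.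
\<close>

lemma Hausdorff_imp_synthesis_on_shilov:
  assumes haus: "Hausdorff_space (tau_r A)"
  shows "synthesis_on A shilov_boundary"
  unfolding synthesis_on_def
proof (intro allI impI)
  fix F assume F: "closed F \<and> F \<subseteq> shilov_boundary"
  let ?J = "closure (locally_vanishing_on A shilov_boundary F)"
  let ?I = "vanishing_on A F"
  note bd = closed_boundary_shilov
  show "?I \<subseteq> ?J"
  proof (rule ccontr)
    assume "\<not> ?I \<subseteq> ?J"
    then have ne: "?I \<noteq> ?J" by blast
    have Iid: "?I \<in> closed_ideals A" and Jid: "?J \<in> closed_ideals A"
      by (rule vanishing_on_closed_ideal closure_locally_vanishing_on_closed_ideal)+
    have "topspace (tau_r A) = closed_ideals A" using one_mem by (intro topspace_tau_r) auto
    with Iid Jid ne have "\<exists>U W. openin (tau_r A) U \<and> openin (tau_r A) W \<and> ?I \<in> U \<and> ?J \<in> W \<and> disjnt U W"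
      using haus[unfolded Hausdorff_space_def, rule_format, of ?I ?J] by simp
    then obtain U W where UW: "openin (tau_r A) U" "openin (tau_r A) W" "?I \<in> U" "?J \<in> W" "disjnt U W"
      by blast
    have "\<forall>V. \<exists>G. open V \<longrightarrow> G \<noteq> bot \<and>
      eventually (\<lambda>I. \<exists>E\<subseteq>V. approximate_peak_set shilov_boundary E \<and> I = vanishing_on A E) G \<and>
      (\<forall>x\<in>shilov_boundary \<inter> V. \<forall>a\<in>A. apply_bcontfun a x \<noteq> 0 \<longrightarrow> eventually (\<lambda>I. norm (apply_bcontfun a x) / 2 < quotient_norm a I) G)"
      using ex_filter_of_peak_ideals by blast
    from choice[OF this] obtain G where G_all: "\<forall>V. open V \<longrightarrow> G V \<noteq> bot \<and>
      eventually (\<lambda>I. \<exists>E\<subseteq>V. approximate_peak_set shilov_boundary E \<and> I = vanishing_on A E) (G V) \<and>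
      (\<forall>x\<in>shilov_boundary \<inter> V. \<forall>a\<in>A. apply_bcontfun a x \<noteq> 0 \<longrightarrow>
        eventually (\<lambda>I. norm (apply_bcontfun a x) / 2 < quotient_norm a I) (G V))" ..
    have G: "\<And>V. open V \<Longrightarrow> G V \<noteq> bot"
      and G_peak: "\<And>V. open V \<Longrightarrow>
        eventually (\<lambda>I. \<exists>E\<subseteq>V. approximate_peak_set shilov_boundary E \<and> I = vanishing_on A E) (G V)"
      and G_large: "\<And>V x a. open V \<Longrightarrow> x \<in> shilov_boundary \<Longrightarrow> x \<in> V \<Longrightarrow> a \<in> A \<Longrightarrow> a x \<noteq> 0 \<Longrightarrow>
        eventually (\<lambda>I. norm (a x) / 2 < quotient_norm a I) (G V)"
      using G_all by blast+
    have G_ideal: "eventually (\<lambda>I. I \<in> closed_ideals A) (G V)" if "open V" for V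
      using G_peak[OF that] by eventually_elim (use vanishing_on_closed_ideal in blast)
    have G_small: "eventually (\<lambda>I. quotient_norm b I < \<epsilon>) (G V)"
      if V: "open V" and b: "b \<in> A" "\<And>x. x \<in> shilov_boundary \<Longrightarrow> x \<in> V \<Longrightarrow> norm (b x) \<le> r" and r: "0 \<le> r" "r < \<epsilon>" for V b r \<epsilon>
      using G_peak[OF V]
    proof eventually_elim
      case (elim I)
      then obtain E where E: "E \<subseteq> V" "approximate_peak_set shilov_boundary E" "I = vanishing_on A E" by blast
      then have "E \<subseteq> shilov_boundary" by (simp add: approximate_peak_set_def)
      then have "quotient_norm b I \<le> r"
        unfolding E(3) using E(1) b by (intro quotient_norm_approximate_peak_set_le[OF bd E(2) b(1) r(1)]) auto
      then show ?case using r(2) by simp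
    qed
    let ?L = "shrinking_filter F G"
    have "eventually (\<lambda>I. I \<in> U) ?L"
    proof (rule tau_r_eventually[OF Iid _ _ _ UW(1,3)])
      show "eventually (\<lambda>I. I \<in> closed_ideals A) ?L"
        unfolding eventually_shrinking_filter using G_ideal by (intro exI[of _ UNIV]) auto
    next
      fix b and \<epsilon> :: real assume b: "b \<in> ?I" and \<epsilon>: "\<epsilon> > 0"
      let ?V0 = "{x. norm (b x) < \<epsilon> / 2}"
      show "eventually (\<lambda>I. quotient_norm b I < \<epsilon>) ?L"
        unfolding eventually_shrinking_filter
      proof (intro exI[of _ ?V0] conjI allI impI)
        show "open ?V0" by (rule open_norm_less)
        show "F \<subseteq> ?V0" using b \<epsilon> by (auto simp: vanishing_on_def)
        fix V assume "open V" "V \<subseteq> ?V0"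
        then show "eventually (\<lambda>I. quotient_norm b I < \<epsilon>) (G V)"
          using b \<epsilon> by (intro G_small[of V b "\<epsilon> / 2"]) (auto simp: vanishing_on_def less_imp_le)
      qed
    next
      fix b assume "b \<in> A" "b \<notin> ?I"
      then obtain x where x: "x \<in> F" "b x \<noteq> 0" by (auto simp: vanishing_on_def)
      have "eventually (\<lambda>I. norm (b x) / 2 < quotient_norm b I) ?L"
        unfolding eventually_shrinking_filter
        using x F \<open>b \<in> A\<close> by (intro exI[of _ UNIV] conjI allI impI G_large) auto
      then show "\<exists>c>0. eventually (\<lambda>I. c < quotient_norm b I) ?L" using x(2) by (intro exI[of _ "norm (b x) / 2"]) auto
    qed
    moreover have "eventually (\<lambda>I. I \<in> W) ?L"
    proof -
      \<comment> \<open>The outer limit: \<open>I(\<Gamma> \<inter> V)\<close> tends to the closure of \<open>J(F)\<close>. The inner limit follows below.\<close>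
      let ?N = "\<lambda>V. vanishing_on A (shilov_boundary \<inter> V)"
      let ?H = "shrinking_filter F (\<lambda>V. principal {?N V})"
      have "eventually (\<lambda>I. I \<in> W) ?H"
      proof (rule tau_r_eventually[OF Jid _ _ _ UW(2,4)])
        show "eventually (\<lambda>I. I \<in> closed_ideals A) ?H"
          unfolding eventually_shrinking_filter eventually_principal
          using vanishing_on_closed_ideal by (intro exI[of _ UNIV]) auto
      next
        fix b and \<epsilon> :: real assume "b \<in> ?J" and "\<epsilon> > 0"
        then obtain j where j: "j \<in> locally_vanishing_on A shilov_boundary F" "dist j b < \<epsilon>"
          unfolding closure_approachable by blast
        then obtain V0 where V0: "j \<in> A" "open V0" "F \<subseteq> V0" "\<forall>x\<in>shilov_boundary \<inter> V0. j x = 0"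
          by (auto simp: locally_vanishing_on_def)
        show "eventually (\<lambda>I. quotient_norm b I < \<epsilon>) ?H"
          unfolding eventually_shrinking_filter eventually_principal
        proof (intro exI[of _ V0] conjI allI impI ballI)
          fix V I assume "V \<subseteq> V0" "I \<in> {?N V}"
          then have "- j \<in> I" using V0 by (auto simp: vanishing_on_def intro: mem_intros)
          from quotient_norm_le[OF this, of b] j(2) show "quotient_norm b I < \<epsilon>"
            by (simp add: dist_norm norm_minus_commute)
        qed (use V0 in auto)
      next
        fix b assume "b \<in> A" "b \<notin> ?J"
        then obtain \<epsilon> where \<epsilon>: "\<epsilon> > 0" "\<And>j. j \<in> locally_vanishing_on A shilov_boundary F \<Longrightarrow> \<epsilon> \<le> dist j b"
          unfolding closure_approachable by (meson not_le)
        have "eventually (\<lambda>I. \<epsilon> / 2 < quotient_norm b I) ?H"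
          unfolding eventually_shrinking_filter eventually_principal
        proof (intro exI[of _ UNIV] conjI allI impI ballI)
          fix V I assume V: "open V" "F \<subseteq> V" "I \<in> {?N V}"
          have "\<epsilon> \<le> quotient_norm b I"
            unfolding quotient_norm_def
          proof (rule cINF_greatest)
            show "I \<noteq> {}" using V(3) closed_idealsD(4)[OF vanishing_on_closed_ideal] by blast
            fix k assume "k \<in> I"
            then have "- k \<in> locally_vanishing_on A shilov_boundary F"
              using V by (auto simp: vanishing_on_def locally_vanishing_on_def intro: mem_intros)
            from \<epsilon>(2)[OF this] show "\<epsilon> \<le> norm (b + k)"
              by (simp add: dist_norm norm_minus_commute[of "- k" b])
          qed
          with \<epsilon>(1) show "\<epsilon> / 2 < quotient_norm b I" by simp
        qed auto
        then show "\<exists>c>0. eventually (\<lambda>I. c < quotient_norm b I) ?H" using \<epsilon>(1) by (intro exI[of _ "\<epsilon> / 2"]) auto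
      qed
      then obtain V0 where V0: "open V0" "F \<subseteq> V0" "\<And>V. open V \<Longrightarrow> F \<subseteq> V \<Longrightarrow> V \<subseteq> V0 \<Longrightarrow> ?N V \<in> W"
        unfolding eventually_shrinking_filter eventually_principal by auto
      \<comment> \<open>The inner limit: \<open>I(P)\<close> tends to \<open>I(\<Gamma> \<inter> V)\<close> along \<open>G V\<close>.\<close>
      have "eventually (\<lambda>I. I \<in> W) (G V)" if V: "open V" "F \<subseteq> V" "V \<subseteq> V0" for V
      proof (rule tau_r_eventually[OF vanishing_on_closed_ideal G_ideal[OF V(1)] _ _ UW(2) V0(3)[OF V]])
        fix b and \<epsilon> :: real assume "b \<in> ?N V" "\<epsilon> > 0"
        then show "eventually (\<lambda>I. quotient_norm b I < \<epsilon>) (G V)"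
          using V(1) by (intro G_small[of V b 0]) (auto simp: vanishing_on_def)
      next
        fix b assume b: "b \<in> A" "b \<notin> ?N V"
        then obtain x where "x \<in> shilov_boundary" "x \<in> V" "b x \<noteq> 0" by (auto simp: vanishing_on_def)
        then show "\<exists>c>0. eventually (\<lambda>I. c < quotient_norm b I) (G V)"
          using V(1) b(1) by (intro exI[of _ "norm (b x) / 2"] conjI G_large) auto
      qed
      then show ?thesis unfolding eventually_shrinking_filter using V0(1,2) by blast
    qed
    ultimately have "eventually (\<lambda>I. False) ?L"
      by eventually_elim (use UW(5) in \<open>auto simp: disjnt_def\<close>)
    then obtain V where "open V" "eventually (\<lambda>I. False) (G V)"
      unfolding eventually_shrinking_filter by blast
    then show False using G by (simp add: trivial_limit_def)
  qed
qed

end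

theorem theorem1p2:
  fixes A :: "('x::t2_space \<Rightarrow>\<^sub>C complex) set"
  assumes "compact (UNIV :: 'x set)"
    and "uniform_algebra A"
  shows "Hausdorff_space (tau_r A) \<longleftrightarrow> spectral_synthesis A"
proof -
  interpret compact_uniform_algebra A
    using assms by (rule compact_uniform_algebra.intro)
  show ?thesis
  proof
    assume "Hausdorff_space (tau_r A)"
    then have "synthesis_on A shilov_boundary" by (rule Hausdorff_imp_synthesis_on_shilov)
    then show "spectral_synthesis A" by (rule synthesis_on_imp_spectral_synthesis[OF closed_boundary_shilov])
  next
    assume "spectral_synthesis A"
    then have "synthesis_on A UNIV" by (rule spectral_synthesis_imp_synthesis_on)
    then show "Hausdorff_space (tau_r A)" by (rule Hausdorff_if_synthesis)
  qed
qed

end
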